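(* Let $f:\mathbb{R}^m\to\mathbb{R}$ be $C^3$ and let $\{x_n\}$ be a sequence constructed by Backtracking New Q-Newton's method (BNQN) with $0<\tau\le1$. 1) Assume $f$ satisfies the Lojasiewicz gradient inequality at each of its critical points, $f$ has at most countably many critical points, and $\nabla f$ satisfies the Lojasiewicz gradient inequality. Then either $\lim_{n\to\infty}\|x_n\|=\infty$ or $\{x_n\}$ converges to a critical point of $f$. 2) Assume $f$ satisfies the Lojasiewicz gradient inequality at each of its critical points, and that $\mu(x^* )(1+\tau)<1$ for every critical point $x^*$ of $f$; if $\tau=1$ assume moreover that $\nabla f$ satisfies the Lojasiewicz gradient inequality. Then either $\lim_{n\to\infty}\|x_n\|=\infty$ or $\{x_n\}$ converges to a critical point of $f$.
   Context: BNQN: fix $m+1$ distinct reals $\delta_0,\dots,\delta_m$, $\tau>0$, $0<\gamma_0<1$, $\kappa=\frac12\min_{i\neq j}|\delta_i-\delta_j|$; $\mathrm{minsp}(A)$ is the minimum absolute value of eigenvalues of a symmetric matrix $A$, and $pr_{A,\pm}$ the orthogonal projections onto the spans of eigenvectors with positive/negative eigenvalues. Given $x_k$: if $\nabla f(x_k)=0$ set $x_{k+1}=x_k$; otherwise let $j$ be the smallest index with $\mathrm{minsp}(\nabla^2 f(x_k)+\delta_j\|\nabla f(x_k)\|^\tau I)\ge\kappa\|\nabla f(x_k)\|^\tau$, $A_k=\nabla^2 f(x_k)+\delta_j\|\nabla f(x_k)\|^\tau I$, $v_k=A_k^{-1}\nabla f(x_k)$, $w_k=pr_{A_k,+}v_k-pr_{A_k,-}v_k$,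 $\widehat{w_k}=w_k/\max\{1,\|w_k\|\}$, $\gamma_k$ the largest $\gamma\in\{\gamma_03^{-n}:n\ge0\}$ with $f(x_k-\gamma\widehat{w_k})-f(x_k)\le-\gamma\langle\widehat{w_k},\nabla f(x_k)\rangle/3$, and $x_{k+1}=x_k-\gamma_k\widehat{w_k}$. A $C^1$ function $g$ satisfies the Lojasiewicz gradient inequality at a point $x^*$ if there exist a neighbourhood $U$ of $x^*$, $0<\mu<1$ and $C>0$ with $|g(x)-g(x^* )|^\mu\le C\|\nabla g(x)\|$ for all $x\in U$. The Lojasiewicz exponent at a critical point $x^*$ of $f$ is $\mu(x^* ):=\inf\{\mu:$ there exist a neighbourhood $U$ of $x^*$ and $C>0$ with $|f(x)-f(x^* )|^\mu\le C\|\nabla f(x)\|$ for all $x\in U\}$. "$\nabla f$ satisfies the Lojasiewicz gradient inequality" means the function $F(x,y)=\langle\nabla f(x),y\rangle$ on $\mathbb{R}^{2m}$ satisfies the Lojasiewicz gradient inequality at every point of $\mathbb{R}^{2m}$. *)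

theory Defs
  imports "HOL-Analysis.Analysis"
begin

definition grad :: "('a::real_inner \<Rightarrow> real) \<Rightarrow> 'a \<Rightarrow> 'a" where
  "grad f x = (THE D. (f has_derivative (\<lambda>h. h \<bullet> D)) (at x))"

definition hess :: "(real^'n \<Rightarrow> real) \<Rightarrow> real^'n \<Rightarrow> real^'n^'n" where
  "hess f x = matrix (frechet_derivative (grad f) (at x))"

definition C3 :: "(real^'n \<Rightarrow> real) \<Rightarrow> bool" where
  "C3 f \<longleftrightarrow> (\<exists>(f1 :: real^'n \<Rightarrow> ((real^'n) \<Rightarrow>\<^sub>L real))
                (f2 :: real^'n \<Rightarrow> ((real^'n) \<Rightarrow>\<^sub>L ((real^'n) \<Rightarrow>\<^sub>L real)))
                (f3 :: real^'n \<Rightarrow> ((real^'n) \<Rightarrow>\<^sub>L ((real^'n) \<Rightarrow>\<^sub>L ((real^'n) \<Rightarrow>\<^sub>L real)))).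
      (\<forall>x. (f has_derivative blinfun_apply (f1 x)) (at x)) \<and>
      (\<forall>x. (f1 has_derivative blinfun_apply (f2 x)) (at x)) \<and>
      (\<forall>x. (f2 has_derivative blinfun_apply (f3 x)) (at x)) \<and>
      continuous_on UNIV f3)"

definition loj_at :: "('a::real_inner \<Rightarrow> real) \<Rightarrow> 'a \<Rightarrow> bool" where
  "loj_at g p \<longleftrightarrow> (\<exists>U \<mu> C. open U \<and> p \<in> U \<and> 0 < \<mu> \<and> \<mu> < 1 \<and> C > 0 \<and>
      (\<forall>x\<in>U. \<bar>g x - g p\<bar> powr \<mu> \<le> C * norm (grad g x)))"

definition loj_exp :: "('a::real_inner \<Rightarrow> real) \<Rightarrow> 'a \<Rightarrow> real" where
  "loj_exp f p = Inf {\<mu>. 0 < \<mu> \<and> (\<exists>U C. open U \<and> p \<in> U \<and> C > 0 \<and>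
      (\<forall>x\<in>U. \<bar>f x - f p\<bar> powr \<mu> \<le> C * norm (grad f x)))}"

definition grad_loj :: "(real^'n \<Rightarrow> real) \<Rightarrow> bool" where
  "grad_loj f \<longleftrightarrow> (\<forall>p. loj_at (\<lambda>z::(real^'n) \<times> (real^'n). grad f (fst z) \<bullet> snd z) p)"

definition eigvals :: "real^'n^'n \<Rightarrow> real set" where
  "eigvals A = {l. \<exists>v. v \<noteq> 0 \<and> A *v v = l *\<^sub>R v}"

definition minsp :: "real^'n^'n \<Rightarrow> real" where
  "minsp A = Min ((\<lambda>l. \<bar>l\<bar>) ` eigvals A)"

definition orth_proj :: "(real^'n) set \<Rightarrow> real^'n \<Rightarrow> real^'n" where
  "orth_proj S v = (THE p. p \<in> S \<and> (\<forall>w\<in>S. (v - p) \<bullet> w = 0))"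

definition pr_pos :: "real^'n^'n \<Rightarrow> real^'n \<Rightarrow> real^'n" where
  "pr_pos A = orth_proj (span {v. \<exists>l>0. A *v v = l *\<^sub>R v})"

definition pr_neg :: "real^'n^'n \<Rightarrow> real^'n \<Rightarrow> real^'n" where
  "pr_neg A = orth_proj (span {v. \<exists>l<0. A *v v = l *\<^sub>R v})"

definition bnqn_kappa :: "(nat \<Rightarrow> real) \<Rightarrow> nat \<Rightarrow> real" where
  "bnqn_kappa \<delta> m = Min {\<bar>\<delta> i - \<delta> j\<bar> | i j. i \<le> m \<and> j \<le> m \<and> i \<noteq> j} / 2"

definition bnqn_step :: "(nat \<Rightarrow> real) \<Rightarrow> real \<Rightarrow> real \<Rightarrow> (real^'n \<Rightarrow> real) \<Rightarrow> real^'n \<Rightarrow> real^'n" where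
  "bnqn_step \<delta> \<tau> \<gamma>0 f x =
    (let g = grad f x in
     if g = 0 then x else
     (let m = CARD('n);
          \<kappa> = bnqn_kappa \<delta> m;
          j = (LEAST j. j \<le> m \<and>
                 minsp (hess f x + (\<delta> j * norm g powr \<tau>) *\<^sub>R mat 1) \<ge> \<kappa> * norm g powr \<tau>);
          A = hess f x + (\<delta> j * norm g powr \<tau>) *\<^sub>R mat 1;
          v = matrix_inv A *v g;
          w = pr_pos A v - pr_neg A v;
          wh = w /\<^sub>R max 1 (norm w);
          n = (LEAST n::nat. f (x - (\<gamma>0 / 3 ^ n) *\<^sub>R wh) - f x \<le> - (\<gamma>0 / 3 ^ n) * (wh \<bullet> g) / 3)
      in x - (\<gamma>0 / 3 ^ n) *\<^sub>R wh))"

definition bnqn_params :: "(nat \<Rightarrow> real) \<Rightarrow> real \<Rightarrow> real \<Rightarrow> nat \<Rightarrow> bool" where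
  "bnqn_params \<delta> \<tau> \<gamma>0 m \<longleftrightarrow> inj_on \<delta> {0..m} \<and> \<tau> > 0 \<and> 0 < \<gamma>0 \<and> \<gamma>0 < 1"

end

theory Submission
  imports Defs
begin

text \<open>
  The step direction is \<open>w = |A|\<inverse> g\<close> with \<open>g\<close> the gradient, and the choice of the shift gives
  \<open>|A| \<ge> s\<close> for \<open>s = \<kappa> * norm g powr \<tau>\<close>. Diagonalising \<open>A\<close> yields
  \<open>s * (norm w)\<^sup>2 \<le> w \<bullet> g\<close> and \<open>(norm g)\<^sup>2 \<le> M * (w \<bullet> g)\<close> locally uniformly. Hence backtracking
  stops at a step size bounded below where the gradient is, so cluster points are critical, and
  one step decreases \<open>f\<close> by at least a constant times \<open>norm g powr (1 + \<tau>)\<close> times its length.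

  If \<open>\<mu> * (1 + \<tau>) < 1\<close>, the last estimate and the Lojasiewicz inequality bound the step length by the
  decrement of a power of \<open>f - f p\<close>, so a sequence that comes close enough to its cluster point
  \<open>p\<close> is trapped there.

  If the critical points are countable, it suffices that the step map is continuous at each of them,
  since a sequence that keeps leaving a small ball around a cluster point then has cluster points on every
  small sphere. For \<open>\<tau> < 1\<close> continuity follows from \<open>norm w \<le> norm g / s\<close>. For \<open>\<tau> = 1\<close> one applies
  the Lojasiewicz inequality for \<open>F (x, y) = grad f x \<bullet> y\<close> at \<open>(x, w)\<close>: the gradient of \<open>F\<close>
  there is \<open>O(norm g)\<close>, so \<open>w \<bullet> g = O(norm g powr (1 / \<mu>))\<close>, which forces \<open>w\<close> to vanish with \<open>g\<close>.
\<close>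

subsection \<open>Eigenbases of symmetric matrices\<close>

text \<open>The Rayleigh quotient attains its maximum \<open>l\<close> on the compact unit sphere of
  \<open>S\<close>. The form \<open>q\<close> is then nonpositive on \<open>S\<close> and zero at
  the maximiser \<open>u\<close>, so its first variation in the direction of the residual
  \<open>T u - l u\<close> must vanish.\<close>

lemma self_adjoint_invariant_eigenvector:
  fixes T :: "'a::euclidean_space \<Rightarrow> 'a"
  assumes T: "linear T" and adj: "\<And>u v. T u \<bullet> v = u \<bullet> T v"
    and S: "subspace S" and inv: "\<And>v. v \<in> S \<Longrightarrow> T v \<in> S" and S0: "S \<noteq> {0}"
  obtains u l where "u \<in> S" "norm u = 1" "T u = l *\<^sub>R u"
proof -
  let ?K = "sphere 0 1 \<inter> S"
  have cpt: "compact ?K"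
    using S by (simp add: closed_subspace compact_Int_closed)
  obtain v where v: "v \<in> S" "v \<noteq> 0"
    using S0 subspace_0[OF S] by blast
  then have "v /\<^sub>R norm v \<in> ?K"
    by (simp add: S subspace_scale)
  then have ne: "?K \<noteq> {}" by blast
  have cont: "continuous_on ?K (\<lambda>v. T v \<bullet> v)"
    by (intro continuous_intros linear_continuous_on) (simp add: T linear_conv_bounded_linear[symmetric])
  obtain u where u: "u \<in> ?K" and max: "\<And>v. v \<in> ?K \<Longrightarrow> T v \<bullet> v \<le> T u \<bullet> u"
    using continuous_attains_sup[OF cpt ne cont] by auto
  define l where "l = T u \<bullet> u"
  define q where "q v = T v \<bullet> v - l * (v \<bullet> v)" for v
  have uu: "u \<bullet> u = 1" "u \<in> S" using u by (auto simp: dot_square_norm)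
  have q: "q v \<le> 0" if "v \<in> S" for v
  proof (cases "v = 0")
    case False
    then have "v /\<^sub>R norm v \<in> ?K"
      using that by (simp add: S subspace_scale)
    from max[OF this] have "T v \<bullet> v / (norm v)\<^sup>2 \<le> l"
      by (simp add: l_def linear_scale[OF T] power2_eq_square field_simps)
    then show ?thesis
      using False by (simp add: q_def dot_square_norm divide_simps)
  qed (simp add: q_def linear_0[OF T])
  define w where "w = T u - l *\<^sub>R u"
  have wS: "w \<in> S"
    unfolding w_def using uu inv S by (simp add: subspace_diff subspace_scale)
  \<comment> \<open>The form \<open>q\<close> is expanded at \<open>u + t w\<close>. The constant
    term is \<open>q u = 0\<close>, and the linear coefficient is twice the inner product of the
    residual with \<open>w\<close>, which is the residual itself.\<close>
  have quad: "2 * t * (w \<bullet> w) + t\<^sup>2 * q w \<le> 0" for t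
  proof -
    have "q (u + t *\<^sub>R w) = q u + t * (T u \<bullet> w + T w \<bullet> u - 2 * l * (u \<bullet> w)) + t\<^sup>2 * q w"
      by (simp add: q_def linear_add[OF T] linear_scale[OF T] algebra_simps power2_eq_square inner_commute)
    also have "T w \<bullet> u = T u \<bullet> w" by (metis adj inner_commute)
    also have "T u \<bullet> w + T u \<bullet> w - 2 * l * (u \<bullet> w) = 2 * (w \<bullet> w)"
      by (subst (3) w_def) (simp add: algebra_simps inner_commute)
    also have "q u = 0" by (simp add: q_def l_def uu)
    finally show ?thesis
      using q[of "u + t *\<^sub>R w"] uu wS S by (simp add: subspace_add subspace_scale)
  qed
  have "w \<bullet> w = 0"
  proof (rule ccontr)
    assume ne: "w \<bullet> w \<noteq> 0"
    then have pos: "w \<bullet> w > 0" by simp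
    \<comment> \<open>So small that the quadratic term can cancel at most half of the linear
      one.\<close>
    define t where "t = (w \<bullet> w) / (1 + \<bar>q w\<bar>)"
    have t: "t > 0" using pos by (simp add: t_def)
    have "t * (2 * (w \<bullet> w) + t * q w) \<le> 0"
      using quad[of t] by (simp add: algebra_simps power2_eq_square)
    then have "2 * (w \<bullet> w) + t * q w \<le> 0"
      using t by (simp add: mult_le_0_iff)
    moreover have "- (t * q w) \<le> t * (1 + \<bar>q w\<bar>)"
      using t by (simp add: abs_if algebra_simps)
    moreover have "t * (1 + \<bar>q w\<bar>) = w \<bullet> w" by (simp add: t_def)
    ultimately show False using pos by linarith
  qed
  then have "T u = l *\<^sub>R u" by (simp add: w_def)
  then show ?thesis using that u by auto
qed

text \<open>Induction on the dimension: a unit eigenvector \<open>u\<close> is split off, and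
  self-adjointness makes its orthogonal complement in \<open>S\<close> invariant again.\<close>

theorem self_adjoint_orthonormal_eigenbasis:
  fixes T :: "'a::euclidean_space \<Rightarrow> 'a"
  assumes T: "linear T" and adj: "\<And>u v. T u \<bullet> v = u \<bullet> T v"
    and S: "subspace S" and inv: "\<And>v. v \<in> S \<Longrightarrow> T v \<in> S"
  shows "\<exists>B l. pairwise orthogonal B \<and> span B = S \<and> (\<forall>b\<in>B. norm b = 1 \<and> T b = l b *\<^sub>R b)"
  using S inv
proof (induction "dim S" arbitrary: S rule: less_induct)
  case less
  show ?case
  proof (cases "S = {0}")
    case True
    then show ?thesis
      by (intro exI[of _ "{}"]) (auto simp: pairwise_def)
  next
    case False
    then obtain u k where u: "u \<in> S" "norm u = 1" "T u = k *\<^sub>R u"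
      using self_adjoint_invariant_eigenvector[OF T adj less.prems] by blast
    define S' where "S' = S \<inter> {y. orthogonal u y}"
    have sub: "subspace S'"
      unfolding S'_def by (intro subspace_inter less.prems subspace_orthogonal_to_vector)
    have uu: "u \<bullet> u = 1" using u by (simp add: dot_square_norm)
    then have "u \<notin> S'" by (simp add: S'_def orthogonal_def)
    then have "dim S' \<noteq> dim S"
      using subspace_dim_equal[OF sub less.prems(1)] u by (auto simp: S'_def)
    moreover have "dim S' \<le> dim S" by (rule dim_subset) (auto simp: S'_def)
    ultimately have "dim S' < dim S" by linarith
    moreover have "T v \<in> S'" if "v \<in> S'" for v
      using that less.prems(2) u adj[of u v, symmetric] by (auto simp: S'_def orthogonal_def)
    ultimately obtain B l where B: "pairwise orthogonal B" "span B = S'"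
      and l: "\<forall>b\<in>B. norm b = 1 \<and> T b = l b *\<^sub>R b"
      using less.hyps sub by blast
    have BS: "B \<subseteq> S'" using B span_superset by blast
    have "span (insert u B) = S"
    proof
      show "span (insert u B) \<subseteq> S"
        using BS u less.prems by (intro span_minimal) (auto simp: S'_def)
      show "S \<subseteq> span (insert u B)"
      proof
        fix v assume "v \<in> S"
        then have "v - (v \<bullet> u) *\<^sub>R u \<in> S'"
          using u less.prems(1)
          by (auto simp: S'_def subspace_diff subspace_scale orthogonal_def uu algebra_simps inner_commute)
        then have "v - (v \<bullet> u) *\<^sub>R u \<in> span B" using B by simp
        then show "v \<in> span (insert u B)" by (auto simp: span_insert)
      qed
    qed
    moreover have "pairwise orthogonal (insert u B)"
      using B BS by (auto simp: pairwise_insert S'_def orthogonal_commute)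
    moreover have "\<forall>b\<in>insert u B. norm b = 1 \<and> T b = (l(u := k)) b *\<^sub>R b"
      using l u BS \<open>u \<notin> S'\<close> by auto
    ultimately show ?thesis by blast
  qed
qed

section \<open>The direction of the method in the coordinates of an eigenbasis\<close>

definition w_dir :: "real^'n^'n \<Rightarrow> real^'n \<Rightarrow> real^'n"
  where "w_dir A g = pr_pos A (matrix_inv A *v g) - pr_neg A (matrix_inv A *v g)"

locale eigenbasis =
  fixes A :: "real^'n^'n" and B :: "(real^'n) set" and l :: "real^'n \<Rightarrow> real"
  assumes orth: "pairwise orthogonal B"
    and span: "span B = UNIV"
    and unit: "b \<in> B \<Longrightarrow> norm b = 1"
    and eigen: "b \<in> B \<Longrightarrow> A *v b = l b *\<^sub>R b"
begin

lemma finite_B: "finite B"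
  using orth by (rule pairwise_orthogonal_imp_finite)

lemma indep: "independent B"
  using orth unit[of 0] by (intro pairwise_orthogonal_independent) auto

lemma card_B: "card B = CARD('n)"
  using indep span by (metis dim_UNIV dim_eq_card dim_span DIM_cart DIM_real mult.right_neutral)

lemma inner_B: "b \<in> B \<Longrightarrow> c \<in> B \<Longrightarrow> b \<bullet> c = (if b = c then 1 else 0)"
  using orth unit by (auto simp: pairwise_def orthogonal_def dot_square_norm)

lemma expand: "(\<Sum>b\<in>B. (v \<bullet> b) *\<^sub>R b) = v"
proof -
  have "(\<Sum>b\<in>B. (b \<bullet> v / (b \<bullet> b)) *\<^sub>R b) = (\<Sum>b\<in>B. (v \<bullet> b) *\<^sub>R b)"
    by (intro sum.cong) (auto simp: inner_B inner_commute)
  then have "orthogonal x (v - (\<Sum>b\<in>B. (v \<bullet> b) *\<^sub>R b))" for x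
    using Gram_Schmidt_step[OF orth, of x v] by (simp add: span)
  from this[of "v - (\<Sum>b\<in>B. (v \<bullet> b) *\<^sub>R b)"] show ?thesis
    by (simp add: orthogonal_def)
qed

lemma parseval: "v \<bullet> w = (\<Sum>b\<in>B. (v \<bullet> b) * (w \<bullet> b))"
  by (subst expand[of v, symmetric]) (simp add: inner_sum_left inner_commute[of w])

lemma eqI: "(\<And>b. b \<in> B \<Longrightarrow> v \<bullet> b = w \<bullet> b) \<Longrightarrow> v = w"
  by (metis (no_types, lifting) expand sum.cong)

lemma inner_A: "b \<in> B \<Longrightarrow> (A *v v) \<bullet> b = l b * (v \<bullet> b)"
proof -
  assume b: "b \<in> B"
  have "A *v v = (\<Sum>c\<in>B. (v \<bullet> c * l c) *\<^sub>R c)"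
    by (subst expand[of v, symmetric])
      (simp add: linear_sum[OF matrix_vector_mul_linear] matrix_vector_mult_scaleR eigen)
  then have "(A *v v) \<bullet> b = (\<Sum>c\<in>B. (v \<bullet> c * l c) * (if c = b then 1 else 0))"
    using b by (simp add: inner_sum_left inner_B)
  also have "\<dots> = l b * (v \<bullet> b)"
    using b finite_B by (simp add: if_distrib cong: if_cong)
  finally show ?thesis .
qed

lemma eigvals_eq: "eigvals A = l ` B"
proof (intro equalityI subsetI)
  fix k assume "k \<in> eigvals A"
  then obtain v where v: "v \<noteq> 0" "A *v v = k *\<^sub>R v" by (auto simp: eigvals_def)
  then obtain b where b: "b \<in> B" "v \<bullet> b \<noteq> 0" using eqI[of v 0] by auto
  then show "k \<in> l ` B" using inner_A[of b v] v by auto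
next
  fix k assume "k \<in> l ` B"
  then obtain b where b: "b \<in> B" "k = l b" by blast
  then have "b \<noteq> 0" using unit[of b] by auto
  then show "k \<in> eigvals A" using b eigen by (auto simp: eigvals_def)
qed

lemma B_nonempty: "B \<noteq> {}"
  using card_B by auto

lemma minsp_le: "b \<in> B \<Longrightarrow> minsp A \<le> \<bar>l b\<bar>"
  unfolding minsp_def eigvals_eq using finite_B by (intro Min_le) auto

lemma minsp_attained: "\<exists>b\<in>B. minsp A = \<bar>l b\<bar>"
proof -
  have "minsp A \<in> (\<lambda>l. \<bar>l\<bar>) ` l ` B"
    unfolding minsp_def eigvals_eq using finite_B B_nonempty by (intro Min_in) auto
  then show ?thesis by auto
qed

text \<open>The candidate \<open>p\<close> keeps the coordinates with positive eigenvalue. The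
  projection is defined through all eigenvectors with positive eigenvalue, not only those in
  \<open>B\<close>, so the residual must be shown orthogonal to each of them.\<close>

lemma pr_pos_inner:
  assumes "b \<in> B"
  shows "pr_pos A v \<bullet> b = (if l b > 0 then v \<bullet> b else 0)"
proof -
  let ?E = "{v. \<exists>k>0. A *v v = k *\<^sub>R v}"
  let ?P = "{b \<in> B. l b > 0}"
  define p where "p = (\<Sum>b\<in>?P. (v \<bullet> b) *\<^sub>R b)"
  have pb: "p \<bullet> b = (if l b > 0 then v \<bullet> b else 0)" if b: "b \<in> B" for b
  proof -
    have "p \<bullet> b = (\<Sum>c\<in>?P. if c = b then v \<bullet> b else 0)"
      unfolding p_def inner_sum_left using b by (intro sum.cong) (auto simp: inner_B)
    then show ?thesis using b finite_B by simp
  qed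
  have p1: "p \<in> span ?E"
    unfolding p_def by (intro span_sum span_scale span_base) (use eigen in blast)
  have "orthogonal (v - p) w" if w: "w \<in> ?E" for w
  proof -
    obtain k where k: "k > 0" "A *v w = k *\<^sub>R w" using w by blast
    \<comment> \<open>A nonzero coordinate of \<open>w\<close> at \<open>b\<close> forces
      \<open>l b = k > 0\<close>, and there \<open>p\<close> agrees with \<open>v\<close>.\<close>
    have "((v - p) \<bullet> b) * (w \<bullet> b) = 0" if b: "b \<in> B" for b
      using inner_A[OF b, of w] k pb[OF b] by (cases "w \<bullet> b = 0") (auto simp: inner_diff_left)
    then show ?thesis unfolding orthogonal_def parseval[of "v - p" w] by (intro sum.neutral) blast
  qed
  then have p2: "(v - p) \<bullet> w = 0" if "w \<in> span ?E" for w
    using that orthogonal_to_span unfolding orthogonal_def by blast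
  have "pr_pos A v = p"
    unfolding pr_pos_def orth_proj_def
  proof (rule the_equality)
    fix q assume q: "q \<in> span ?E \<and> (\<forall>w\<in>span ?E. (v - q) \<bullet> w = 0)"
    have d: "p - q \<in> span ?E" using p1 q by (simp add: span_diff)
    have "(p - q) \<bullet> (p - q) = (v - q) \<bullet> (p - q) - (v - p) \<bullet> (p - q)"
      by (simp add: inner_diff_left)
    also have "\<dots> = 0" using d p2 q by simp
    finally show "q = p" by simp
  qed (use p1 p2 in blast)
  then show ?thesis using pb assms by simp
qed

lemma neg: "eigenbasis (- A) B (\<lambda>b. - l b)"
proof
  fix b assume "b \<in> B"
  then show "(- A) *v b = (- l b) *\<^sub>R b"
    using eigen[of b] matrix_vector_mult_diff_rdistrib[of 0 A b] by simp
qed (use orth span unit in auto)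

text \<open>The negative projection of \<open>A\<close> is the positive projection of
  \<open>- A\<close>.\<close>

lemma pr_neg_inner:
  assumes "b \<in> B"
  shows "pr_neg A v \<bullet> b = (if l b < 0 then v \<bullet> b else 0)"
proof -
  have m: "(- A) *v v = - (A *v v)" for v
    using matrix_vector_mult_diff_rdistrib[of 0 A v] by simp
  have "{v. \<exists>k<0. A *v v = k *\<^sub>R v} = {v. \<exists>k>0. (- A) *v v = k *\<^sub>R v}"
    unfolding m by (auto, metis neg_0_less_iff_less scaleR_minus_left, metis minus_equation_iff neg_less_0_iff_less scaleR_minus_left)
  then have "pr_neg A = pr_pos (- A)" by (simp add: pr_neg_def pr_pos_def)
  then show ?thesis using eigenbasis.pr_pos_inner[OF neg assms] by simp
qed

context
  fixes s :: real
  assumes s: "0 < s" "s \<le> minsp A"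
begin

lemma s_le: "b \<in> B \<Longrightarrow> s \<le> \<bar>l b\<bar>"
  using minsp_le s by fastforce

lemma matrix_inv_mult: "A *v (matrix_inv A *v g) = g"
proof -
  have "inj ((*v) A)"
  proof (rule injI)
    fix x y assume eq: "A *v x = A *v y"
    show "x = y"
    proof (rule eqI)
      fix b assume b: "b \<in> B"
      show "x \<bullet> b = y \<bullet> b"
        using inner_A[OF b, of x] inner_A[OF b, of y] eq s_le[OF b] s by auto
    qed
  qed
  then have "invertible A"
    by (metis invertible_left_inverse matrix_left_invertible_injective)
  then have "A ** matrix_inv A = mat 1"
    unfolding invertible_def matrix_inv_def by (rule someI2_ex) blast
  then show ?thesis by (simp add: matrix_vector_mul_assoc)
qed

text \<open>Identifies \<open>w_dir A g\<close> with |A|^-1 g: the solution of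
  \<open>A v = g\<close> has coordinates \<open>(g \<bullet> b) / l b\<close>, and subtracting the
  negative projection flips the sign exactly where \<open>l b\<close> is negative.\<close>

lemma w_dir_inner: "b \<in> B \<Longrightarrow> w_dir A g \<bullet> b = (g \<bullet> b) / \<bar>l b\<bar>"
  using inner_A[of b "matrix_inv A *v g"] s_le[of b] s
  by (auto simp: matrix_inv_mult w_dir_def inner_diff_left pr_pos_inner pr_neg_inner)

text \<open>Holds coordinate by coordinate, since \<open>g \<bullet> b\<close> is
  \<open>\<bar>l b\<bar>\<close> times the coordinate of the direction and
  \<open>s \<le> \<bar>l b\<bar>\<close>.\<close>

lemma w_dir_inner_ge: "s * (norm (w_dir A g))\<^sup>2 \<le> w_dir A g \<bullet> g"
  unfolding power2_norm_eq_inner parseval[of "w_dir A g" "w_dir A g"] parseval[of "w_dir A g" g] sum_distrib_left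
proof (rule sum_mono)
  fix b assume b: "b \<in> B"
  have "g \<bullet> b = \<bar>l b\<bar> * (w_dir A g \<bullet> b)"
    using s_le[OF b] s by (auto simp: w_dir_inner[OF b])
  moreover have "s * (w_dir A g \<bullet> b)\<^sup>2 \<le> \<bar>l b\<bar> * (w_dir A g \<bullet> b)\<^sup>2"
    using s_le[OF b] by (intro mult_right_mono) auto
  ultimately show "s * (w_dir A g \<bullet> b * (w_dir A g \<bullet> b)) \<le> w_dir A g \<bullet> b * (g \<bullet> b)"
    by (simp add: power2_eq_square algebra_simps)
qed

lemma norm_w_dir_le: "norm (w_dir A g) \<le> norm g / s"
proof (cases "w_dir A g = 0")
  case False
  have "s * (norm (w_dir A g))\<^sup>2 \<le> norm (w_dir A g) * norm g"
    using w_dir_inner_ge norm_cauchy_schwarz order_trans by blast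
  then have "norm (w_dir A g) * (s * norm (w_dir A g)) \<le> norm (w_dir A g) * norm g"
    by (simp add: power2_eq_square algebra_simps)
  then have "s * norm (w_dir A g) \<le> norm g"
    using False by simp
  then show ?thesis using s by (simp add: field_simps)
qed (use s in simp)

text \<open>\<open>A\<close> and |A| differ only by signs in the eigenbasis, so applying
  \<open>A\<close> to |A|^-1 g gives back the coordinates of \<open>g\<close> up to sign.\<close>

lemma norm_A_w_dir: "norm (A *v w_dir A g) = norm g"
proof -
  have "(A *v w_dir A g) \<bullet> (A *v w_dir A g) = g \<bullet> g"
    unfolding parseval[of g g] parseval[of "A *v w_dir A g" "A *v w_dir A g"]
  proof (rule sum.cong)
    fix b assume b: "b \<in> B"
    have "l b \<noteq> 0" using s_le[OF b] s by auto
    then show "(A *v w_dir A g) \<bullet> b * ((A *v w_dir A g) \<bullet> b) = g \<bullet> b * (g \<bullet> b)"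
      using b by (simp add: inner_A w_dir_inner)
  qed simp
  then show ?thesis by (simp add: norm_eq_sqrt_inner)
qed

text \<open>Every \<open>\<bar>l b\<bar>\<close> is at most \<open>M\<close>, so |A|^-1 is at least
  1/M as a quadratic form.\<close>

lemma norm_le_w_dir_inner:
  assumes "\<And>v. norm (A *v v) \<le> M * norm v"
  shows "(norm g)\<^sup>2 \<le> M * (w_dir A g \<bullet> g)"
  unfolding power2_norm_eq_inner parseval[of g g] parseval[of "w_dir A g" g] sum_distrib_left
proof (rule sum_mono)
  fix b assume b: "b \<in> B"
  have "\<bar>l b\<bar> \<le> M" using assms[of b] by (simp add: eigen unit b)
  then have "\<bar>l b\<bar> * (g \<bullet> b)\<^sup>2 \<le> M * (g \<bullet> b)\<^sup>2" by (intro mult_right_mono) auto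
  moreover have lb: "0 < \<bar>l b\<bar>" using s_le[OF b] s by linarith
  ultimately show "g \<bullet> b * (g \<bullet> b) \<le> M * (w_dir A g \<bullet> b * (g \<bullet> b))"
    by (simp add: w_dir_inner[OF b] divide_simps power2_eq_square mult.commute)
qed

end

end

lemma symmetric_eigenbasis:
  fixes A :: "real^'n^'n"
  assumes "\<And>u v. (A *v u) \<bullet> v = u \<bullet> (A *v v)"
  obtains B l where "eigenbasis A B l"
proof -
  obtain B l where "pairwise orthogonal B \<and> span B = UNIV \<and> (\<forall>b\<in>B. norm b = 1 \<and> A *v b = l b *\<^sub>R b)"
    using self_adjoint_orthonormal_eigenbasis[of "(*v) A" UNIV] assms by auto
  then show thesis by (intro that[of B l]) (auto simp: eigenbasis_def)
qed

text \<open>One eigenbasis of the Hessian thus serves all candidate shifts at once.\<close>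

lemma eigenbasis_shift:
  assumes "eigenbasis H B l"
  shows "eigenbasis (H + c *\<^sub>R mat 1) B (\<lambda>b. l b + c)"
proof -
  interpret eigenbasis H B l by fact
  show ?thesis
  proof
    fix b assume "b \<in> B"
    then show "(H + c *\<^sub>R mat 1) *v b = (l b + c) *\<^sub>R b"
      by (simp add: matrix_vector_mult_add_rdistrib scaleR_matrix_vector_assoc[symmetric] eigen scaleR_add_left)
  qed (use orth span unit in auto)
qed

subsection \<open>Gradient and Hessian\<close>

lemma has_real_derivative_along_line:
  fixes f :: "'a::real_normed_vector \<Rightarrow> real"
  assumes "(f has_derivative D) (at (x + t *\<^sub>R u))"
  shows "((\<lambda>t. f (x + t *\<^sub>R u)) has_real_derivative D u) (at t)"
proof -
  interpret D: bounded_linear D using assms by (rule has_derivative_bounded_linear)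
  have "((\<lambda>t. x + t *\<^sub>R u) has_derivative (\<lambda>d. d *\<^sub>R u)) (at t)"
    by (auto intro!: derivative_eq_intros)
  from has_derivative_compose[OF this assms] show ?thesis
    by (simp add: has_field_derivative_def D.scaleR mult.commute[of _ "D u"])
qed

context
  fixes f :: "'a::real_normed_vector \<Rightarrow> real"
    and f1 :: "'a \<Rightarrow> 'a \<Rightarrow>\<^sub>L real" and f2 :: "'a \<Rightarrow> 'a \<Rightarrow>\<^sub>L 'a \<Rightarrow>\<^sub>L real"
  assumes f1: "\<And>x. (f has_derivative f1 x) (at x)"
    and f2: "\<And>x. (f1 has_derivative f2 x) (at x)"
begin

text \<open>Two uses of the mean value theorem: along \<open>u\<close> for the increment of
  \<open>f\<close> over \<open>h v\<close>, then along \<open>v\<close> for the first derivative in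
  direction \<open>u\<close>.\<close>

lemma second_difference_mean_value:
  assumes h: "0 < h"
  shows "\<exists>\<xi> \<eta>. \<bar>\<xi>\<bar> \<le> h \<and> \<bar>\<eta>\<bar> \<le> h \<and>
    f (x + h *\<^sub>R u + h *\<^sub>R v) - f (x + h *\<^sub>R u) - f (x + h *\<^sub>R v) + f x
      = h\<^sup>2 * f2 (x + \<xi> *\<^sub>R u + \<eta> *\<^sub>R v) v u"
proof -
  define G where "G s = f ((x + h *\<^sub>R v) + s *\<^sub>R u) - f (x + s *\<^sub>R u)" for s
  have "(G has_real_derivative (f1 ((x + h *\<^sub>R v) + s *\<^sub>R u) u - f1 (x + s *\<^sub>R u) u)) (at s)" for s
    unfolding G_def by (intro derivative_intros has_real_derivative_along_line f1)
  from MVT2[OF h, of G, OF this] obtain \<xi> where \<xi>: "0 < \<xi>" "\<xi> < h"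
    and G: "G h - G 0 = h * (f1 ((x + h *\<^sub>R v) + \<xi> *\<^sub>R u) u - f1 (x + \<xi> *\<^sub>R u) u)"
    by auto
  define K where "K t = f1 ((x + \<xi> *\<^sub>R u) + t *\<^sub>R v) u" for t
  have D: "((\<lambda>y. f1 y u) has_derivative (\<lambda>d. f2 y d u)) (at y)" for y
    by (rule bounded_linear.has_derivative[OF blinfun.bounded_linear_left f2])
  have "(K has_real_derivative f2 ((x + \<xi> *\<^sub>R u) + t *\<^sub>R v) v u) (at t)" for t
    unfolding K_def by (rule has_real_derivative_along_line[OF D])
  from MVT2[OF h, of K, OF this] obtain \<eta> where \<eta>: "0 < \<eta>" "\<eta> < h"
    and K: "K h - K 0 = h * f2 ((x + \<xi> *\<^sub>R u) + \<eta> *\<^sub>R v) v u"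
    by auto
  have "f (x + h *\<^sub>R u + h *\<^sub>R v) - f (x + h *\<^sub>R u) - f (x + h *\<^sub>R v) + f x = G h - G 0"
    by (simp add: G_def algebra_simps)
  also have "\<dots> = h * (K h - K 0)" unfolding G K_def by (simp add: algebra_simps)
  finally show ?thesis
    using \<xi> \<eta> K by (intro exI[of _ \<xi>] exI[of _ \<eta>]) (simp add: power2_eq_square)
qed

text \<open>The second difference is symmetric in \<open>u\<close> and \<open>v\<close>, so its two
  mean value expressions agree at every scale \<open>h n\<close>. Continuity of \<open>f2\<close> at
  \<open>x\<close> carries the equality to the limit.\<close>

lemma second_derivative_symmetric:
  assumes cont: "isCont f2 x"
  shows "f2 x u v = f2 x v u"
proof -
  define h where "h n = inverse (real (Suc n))" for n
  have h: "h n > 0" for n by (simp add: h_def)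
  have h0: "h \<longlonglongrightarrow> 0" unfolding h_def by (rule LIMSEQ_inverse_real_of_nat)
  have lim: "(\<lambda>n. f2 (x + a n *\<^sub>R u + b n *\<^sub>R v) p q) \<longlonglongrightarrow> f2 x p q"
    if "\<And>n. \<bar>a n\<bar> \<le> h n" "\<And>n. \<bar>b n\<bar> \<le> h n" for a b u v p q
  proof -
    have "a \<longlonglongrightarrow> 0" "b \<longlonglongrightarrow> 0"
      by (rule Lim_null_comparison[OF _ h0], simp add: that)+
    then have "(\<lambda>n. x + a n *\<^sub>R u + b n *\<^sub>R v) \<longlonglongrightarrow> x"
      by (auto intro!: tendsto_eq_intros)
    from isCont_tendsto_compose[OF cont this]
    have "(\<lambda>n. f2 (x + a n *\<^sub>R u + b n *\<^sub>R v)) \<longlonglongrightarrow> f2 x" .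
    then show ?thesis
      by (intro blinfun.tendsto tendsto_const)
  qed
  obtain a b where ab: "\<And>n. \<bar>a n\<bar> \<le> h n" "\<And>n. \<bar>b n\<bar> \<le> h n"
    and 1: "\<And>n. f (x + h n *\<^sub>R u + h n *\<^sub>R v) - f (x + h n *\<^sub>R u) - f (x + h n *\<^sub>R v) + f x
      = (h n)\<^sup>2 * f2 (x + a n *\<^sub>R u + b n *\<^sub>R v) v u"
    using second_difference_mean_value[OF h, of _ x u v] by metis
  obtain c d where cd: "\<And>n. \<bar>c n\<bar> \<le> h n" "\<And>n. \<bar>d n\<bar> \<le> h n"
    and 2: "\<And>n. f (x + h n *\<^sub>R v + h n *\<^sub>R u) - f (x + h n *\<^sub>R v) - f (x + h n *\<^sub>R u) + f x
      = (h n)\<^sup>2 * f2 (x + c n *\<^sub>R v + d n *\<^sub>R u) u v"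
    using second_difference_mean_value[OF h, of _ x v u] by metis
  have "f2 (x + a n *\<^sub>R u + b n *\<^sub>R v) v u = f2 (x + c n *\<^sub>R v + d n *\<^sub>R u) u v" for n
  proof -
    have "(h n)\<^sup>2 * f2 (x + a n *\<^sub>R u + b n *\<^sub>R v) v u = (h n)\<^sup>2 * f2 (x + c n *\<^sub>R v + d n *\<^sub>R u) u v"
      unfolding 1[symmetric] 2[symmetric] by (simp add: algebra_simps)
    then show ?thesis using h[of n] by simp
  qed
  with lim[OF ab, of u v v u] have "(\<lambda>n. f2 (x + c n *\<^sub>R v + d n *\<^sub>R u) u v) \<longlonglongrightarrow> f2 x v u" by simp
  with lim[OF cd, of v u u v] show ?thesis by (rule LIMSEQ_unique)
qed

end

lemma grad_eqI:
  assumes "(f has_derivative (\<lambda>h. h \<bullet> D)) (at x)"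
  shows "grad f x = D"
  unfolding grad_def
proof (rule the_equality)
  show "(f has_derivative (\<lambda>h. h \<bullet> D)) (at x)" by (rule assms)
next
  fix D' assume "(f has_derivative (\<lambda>h. h \<bullet> D')) (at x)"
  from has_derivative_unique[OF this assms] have "h \<bullet> D' = h \<bullet> D" for h by metis
  then show "D' = D" by (metis inner_commute vector_eq_ldot)
qed

locale C3_function =
  fixes f :: "real^'n \<Rightarrow> real"
  assumes C3: "C3 f"
begin

text \<open>The functional-valued derivatives in \<open>C3\<close> are turned into a vector
  \<open>D x\<close> and a linear map \<open>E x\<close> by Riesz representation. Symmetry is that
  of the second derivative, and the bound on a ball comes from compactness, as \<open>f2\<close> is
  differentiable and so continuous.\<close>

lemma grad_hess:
  shows has_derivative_grad: "(f has_derivative (\<lambda>h. h \<bullet> grad f x)) (at x)"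
    and has_derivative_hess: "(grad f has_derivative (\<lambda>h. hess f x *v h)) (at x)"
    and hess_symmetric: "(hess f x *v u) \<bullet> v = u \<bullet> (hess f x *v v)"
    and hess_bounded: "\<exists>K>0. \<forall>x\<in>cball 0 R. \<forall>v. norm (hess f x *v v) \<le> K * norm v"
proof -
  obtain f1 f2 f3 where f1: "\<And>x. (f has_derivative blinfun_apply (f1 x)) (at x)"
    and f2: "\<And>x. (f1 has_derivative blinfun_apply (f2 x)) (at x)"
    and f3: "\<And>x. (f2 has_derivative blinfun_apply (f3 x)) (at x)"
    using C3 unfolding C3_def by metis
  define D where "D x = (\<Sum>i\<in>Basis. f1 x i *\<^sub>R i)" for x
  define E where "E x h = (\<Sum>i\<in>Basis. f2 x h i *\<^sub>R i)" for x h
  have expand: "F h = h \<bullet> (\<Sum>i\<in>Basis. F i *\<^sub>R i)" for F :: "(real^'n) \<Rightarrow>\<^sub>L real" and h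
    by (subst euclidean_representation[of h, symmetric])
      (simp add: blinfun.sum_right blinfun.scaleR_right inner_sum_right mult.commute)
  have grad: "(f has_derivative (\<lambda>h. h \<bullet> D x)) (at x)" for x
    using f1[of x] expand[of "f1 x"] unfolding D_def by (metis (no_types, lifting) ext)
  then have D: "grad f = D" by (metis grad_eqI ext)
  show "(f has_derivative (\<lambda>h. h \<bullet> grad f x)) (at x)" unfolding D by (rule grad)
  have E: "(D has_derivative E x) (at x)" for x
    unfolding D_def E_def
    by (intro has_derivative_sum has_derivative_scaleR_left
        bounded_linear.has_derivative[OF blinfun.bounded_linear_left f2])
  have "bounded_linear (E x)" for x by (rule has_derivative_bounded_linear[OF E])
  then have H: "hess f x *v h = E x h" for x h
    unfolding hess_def D frechet_derivative_at[OF E, symmetric] by (metis matrix_vector_mul(3))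
  show "(grad f has_derivative (\<lambda>h. hess f x *v h)) (at x)" unfolding D H by (rule E)
  have E2: "u \<bullet> E x h = f2 x h u" for x h u unfolding E_def by (rule expand[symmetric])
  have cont: "isCont f2 x" for x by (rule has_derivative_continuous[OF f3])
  show "(hess f x *v u) \<bullet> v = u \<bullet> (hess f x *v v)"
    unfolding H inner_commute[of "E x u"] E2 by (rule second_derivative_symmetric[of f f1 f2, OF f1 f2 cont])
  have "compact (f2 ` cball 0 R)"
    using cont by (intro compact_continuous_image continuous_at_imp_continuous_on) auto
  then have "bounded (f2 ` cball 0 R)" by (rule compact_imp_bounded)
  then obtain K where K: "K > 0" "\<And>x. x \<in> cball 0 R \<Longrightarrow> norm (f2 x) \<le> K"
    unfolding bounded_pos by blast
  have "norm (hess f x *v v) \<le> K * norm v" if x: "x \<in> cball 0 R" for x v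
  proof (cases "E x v = 0")
    case False
    \<comment> \<open>The functional \<open>f2 x v\<close> is tested on the vector that represents
      it.\<close>
    have "norm (E x v) * norm (E x v) = f2 x v (E x v)"
      by (metis E2 norm_eq_square power2_eq_square dot_square_norm)
    also have "\<dots> \<le> norm (f2 x v) * norm (E x v)"
      by (metis abs_le_D1 norm_blinfun real_norm_def)
    also have "\<dots> \<le> (norm (f2 x) * norm v) * norm (E x v)"
      by (intro mult_right_mono norm_blinfun) auto
    finally have "norm (E x v) \<le> norm (f2 x) * norm v" using False by simp
    also have "\<dots> \<le> K * norm v" using K x by (intro mult_right_mono) auto
    finally show ?thesis unfolding H .
  qed (use K in \<open>simp add: H\<close>)
  then show "\<exists>K>0. \<forall>x\<in>cball 0 R. \<forall>v. norm (hess f x *v v) \<le> K * norm v"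
    using K by blast
qed

lemma isCont_f: "isCont f x"
  by (rule has_derivative_continuous[OF has_derivative_grad])

lemma isCont_grad: "isCont (grad f) x"
  by (rule has_derivative_continuous[OF has_derivative_hess])

text \<open>Mean value theorem along the segment, plus the Lipschitz bound that the Hessian gives
  for the gradient. The ball of radius \<open>R + 1\<close> contains every segment because
  \<open>norm h \<le> 1\<close>.\<close>

lemma descent:
  "\<exists>L>0. \<forall>x\<in>cball 0 R. \<forall>h. norm h \<le> 1 \<longrightarrow> f (x + h) - f x \<le> h \<bullet> grad f x + L * (norm h)\<^sup>2"
proof -
  obtain L where L: "L > 0" "\<And>x v. x \<in> cball 0 (R + 1) \<Longrightarrow> norm (hess f x *v v) \<le> L * norm v"
    using hess_bounded by blast
  have "f (x + h) - f x \<le> h \<bullet> grad f x + L * (norm h)\<^sup>2" if x: "x \<in> cball 0 R" and h: "norm h \<le> 1" for x h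
  proof -
    obtain t where t: "0 < t" "t < 1" and f: "f (x + h) - f x = h \<bullet> grad f (x + t *\<^sub>R h)"
      using MVT2[of 0 1 "\<lambda>t. f (x + t *\<^sub>R h)", OF _ has_real_derivative_along_line[OF has_derivative_grad]]
      by auto
    have th: "norm (t *\<^sub>R h) \<le> norm h" using t by (simp add: mult_left_le_one_le)
    have xt: "x + t *\<^sub>R h \<in> cball 0 (R + 1)" "x \<in> cball 0 (R + 1)"
      using x h th norm_triangle_ineq[of x "t *\<^sub>R h"] by auto
    have "norm (grad f (x + t *\<^sub>R h) - grad f x) \<le> L * norm (x + t *\<^sub>R h - x)"
    proof (rule differentiable_bound[OF convex_cball _ _ xt])
      fix y :: "real^'n" assume y: "y \<in> cball 0 (R + 1)"
      show "(grad f has_derivative (\<lambda>h. hess f y *v h)) (at y within cball 0 (R + 1))"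
        by (rule has_derivative_at_withinI[OF has_derivative_hess])
      show "onorm ((*v) (hess f y)) \<le> L" using L(2)[OF y] by (rule onorm_le)
    qed
    also have "\<dots> \<le> L * norm h" using th L by simp
    finally have g: "norm (grad f (x + t *\<^sub>R h) - grad f x) \<le> L * norm h" .
    have "h \<bullet> grad f (x + t *\<^sub>R h) = h \<bullet> grad f x + h \<bullet> (grad f (x + t *\<^sub>R h) - grad f x)"
      by (simp add: inner_diff_right)
    also have "h \<bullet> (grad f (x + t *\<^sub>R h) - grad f x) \<le> norm h * norm (grad f (x + t *\<^sub>R h) - grad f x)"
      by (rule norm_cauchy_schwarz)
    also have "\<dots> \<le> norm h * (L * norm h)" using g by (intro mult_left_mono) auto
    finally show ?thesis unfolding f by (simp add: power2_eq_square algebra_simps)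
  qed
  then show ?thesis using L by blast
qed

end

subsection \<open>Convergence of sequences with a cluster point\<close>

lemma bounded_infinite_imp_convergent_subsequence:
  fixes x :: "nat \<Rightarrow> 'a::heine_borel"
  assumes "infinite I" "bounded (x ` I)"
  obtains s q where "strict_mono s" "range s \<subseteq> I" "(x \<circ> s) \<longlonglongrightarrow> q"
proof -
  have "range (x \<circ> enumerate I) \<subseteq> x ` I"
    using enumerate_in_set[OF assms(1)] by auto
  then have "bounded (range (x \<circ> enumerate I))" using assms(2) bounded_subset by blast
  then obtain q r where r: "strict_mono r" "((x \<circ> enumerate I) \<circ> r) \<longlonglongrightarrow> q"
    using bounded_imp_convergent_subsequence by blast
  show thesis
  proof (rule that)
    show "strict_mono (enumerate I \<circ> r)"
      using r strict_mono_enumerate[OF assms(1)] by (simp add: strict_mono_o)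
    show "range (enumerate I \<circ> r) \<subseteq> I" using enumerate_in_set[OF assms(1)] by auto
    show "(x \<circ> (enumerate I \<circ> r)) \<longlonglongrightarrow> q" using r by (simp add: o_assoc)
  qed
qed

lemma cluster_point_if_norm_not_at_top:
  fixes x :: "nat \<Rightarrow> 'a::euclidean_space"
  assumes "\<not> filterlim (\<lambda>k. norm (x k)) at_top sequentially"
  obtains s q where "strict_mono s" "(x \<circ> s) \<longlonglongrightarrow> q"
proof -
  obtain Z where Z: "\<not> eventually (\<lambda>k. Z \<le> norm (x k)) sequentially"
    using assms unfolding filterlim_at_top by blast
  define I where "I = {k. \<not> Z \<le> norm (x k)}"
  have "infinite I"
    using Z unfolding I_def cofinite_eq_sequentially[symmetric] eventually_cofinite by simp
  moreover have "bounded (x ` I)"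
    unfolding bounded_iff I_def by (intro exI[of _ Z]) auto
  ultimately show thesis
    by (rule bounded_infinite_imp_convergent_subsequence) (rule that)
qed

text \<open>A trapping argument: once \<open>x N\<close> is near \<open>p\<close> and
  \<open>\<phi> N\<close> is small, the path travelled after \<open>N\<close> is shorter than
  \<open>\<phi> N\<close>, so the sequence never leaves the ball in which the step estimate
  holds.\<close>

lemma converges_to_cluster_point_if_length_controlled:
  fixes x :: "nat \<Rightarrow> 'a::metric_space" and \<phi> :: "nat \<Rightarrow> real"
  assumes r: "r > 0"
    and step: "\<And>k. dist (x k) p < r \<Longrightarrow> dist (x k) (x (Suc k)) \<le> \<phi> k - \<phi> (Suc k)"
    and nonneg: "\<And>k. 0 \<le> \<phi> k" and lim: "\<phi> \<longlonglongrightarrow> 0"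
    and s: "strict_mono s" "(x \<circ> s) \<longlonglongrightarrow> p"
  shows "x \<longlonglongrightarrow> p"
proof (rule metric_LIMSEQ_I)
  fix e :: real assume e: "e > 0"
  define d where "d = min e r"
  have d: "d > 0" using e r by (simp add: d_def)
  have "eventually (\<lambda>n. dist ((x \<circ> s) n) p < d / 2) sequentially"
    using tendstoD[OF s(2), of "d / 2"] d by simp
  moreover have "(\<phi> \<circ> s) \<longlonglongrightarrow> 0" using lim s LIMSEQ_subseq_LIMSEQ by blast
  from order_tendstoD(2)[OF this, of "d / 2"]
  have "eventually (\<lambda>n. (\<phi> \<circ> s) n < d / 2) sequentially" using d by simp
  ultimately obtain n where "dist ((x \<circ> s) n) p < d / 2" "(\<phi> \<circ> s) n < d / 2"
    using eventually_happens'[OF sequentially_bot eventually_conj] by blast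
  then obtain N where N: "dist (x N) p < d / 2" "\<phi> N < d / 2" by auto
  have close: "dist (x k) p < d" if "dist (x N) (x k) \<le> \<phi> N - \<phi> k" for k
    using dist_triangle[of "x k" p "x N"] that N nonneg[of k] by (simp add: dist_commute)
  have "dist (x N) (x (N + m)) \<le> \<phi> N - \<phi> (N + m)" for m
  proof (induction m)
    case (Suc m)
    have "dist (x (N + m)) p < r" using close[OF Suc] by (simp add: d_def)
    from step[OF this] Suc dist_triangle[of "x N" "x (Suc (N + m))" "x (N + m)"] show ?case by simp
  qed simp
  then have "dist (x n) p < e" if "n \<ge> N" for n
    using close[of n] that by (metis d_def le_add_diff_inverse min_less_iff_conj)
  then show "\<exists>no. \<forall>n\<ge>no. dist (x n) p < e" by blast
qed

text \<open>Without convergence the sequence crosses a sphere around \<open>p\<close> infinitely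
  often. A cluster point of the last iterates inside is also the limit of their successors outside,
  so it lies on the sphere. The radius is chosen so that the sphere misses \<open>Z\<close>.\<close>

lemma converges_if_countably_many_cluster_points:
  fixes x :: "nat \<Rightarrow> 'a::heine_borel"
  assumes Z: "countable Z"
    and cluster: "\<And>s q. strict_mono s \<Longrightarrow> (x \<circ> s) \<longlonglongrightarrow> q \<Longrightarrow> q \<in> Z"
    and step: "\<And>s q. strict_mono s \<Longrightarrow> (x \<circ> s) \<longlonglongrightarrow> q \<Longrightarrow> (\<lambda>n. x (Suc (s n))) \<longlonglongrightarrow> q"
    and s: "strict_mono s" "(x \<circ> s) \<longlonglongrightarrow> p"
  shows "x \<longlonglongrightarrow> p"
proof (rule ccontr)
  assume "\<not> x \<longlonglongrightarrow> p"
  then obtain R where R: "R > 0" and out: "\<And>N. \<exists>n\<ge>N. R \<le> dist (x n) p"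
    unfolding lim_sequentially by (metis not_less)
  have "uncountable ({0<..<R} - dist p ` Z)"
    using R Z by (intro uncountable_minus_countable) (auto simp: uncountable_open_interval)
  then obtain r where r: "0 < r" "r < R" "r \<notin> dist p ` Z"
    by (metis Diff_iff all_not_in_conv countable_empty greaterThanLessThan_iff)
  \<comment> \<open>The exit times: \<open>x k\<close> is inside the ball of radius \<open>r\<close>
    and its successor is not.\<close>
  define I where "I = {k. dist (x k) p < r \<and> r \<le> dist (x (Suc k)) p}"
  have "\<exists>k\<ge>m. k \<in> I" for m
  proof -
    have "eventually (\<lambda>n. dist ((x \<circ> s) n) p < r \<and> n \<ge> m) sequentially"
      using tendstoD[OF s(2) r(1)] by (intro eventually_conj eventually_ge_at_top)
    from eventually_happens'[OF sequentially_bot this]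
    obtain n0 where n0: "dist (x (s n0)) p < r" "n0 \<ge> m" by auto
    define n where "n = s n0"
    have n: "dist (x n) p < r" "n \<ge> m"
      using n0 seq_suble[OF s(1), of n0] by (auto simp: n_def)
    \<comment> \<open>The first index from \<open>n\<close> on that is outside the ball; its
      predecessor is an exit time.\<close>
    define k where "k = (LEAST k. k \<ge> n \<and> r \<le> dist (x k) p)"
    have "\<exists>k\<ge>n. r \<le> dist (x k) p" using out[of n] r by force
    from LeastI_ex[OF this] have k: "k \<ge> n" "r \<le> dist (x k) p" unfolding k_def by auto
    then have "k > n" using n by (cases "k = n") auto
    then have "\<not> (k - 1 \<ge> n \<and> r \<le> dist (x (k - 1)) p)"
      unfolding k_def by (intro not_less_Least) simp
    then have "k - 1 \<in> I" using \<open>k > n\<close> k by (auto simp: I_def)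
    then show ?thesis using n \<open>k > n\<close> by (intro exI[of _ "k - 1"]) auto
  qed
  then have inf: "infinite I" by (metis infinite_nat_iff_unbounded_le)
  have "bounded (x ` I)"
    by (rule bounded_subset[OF bounded_cball[of p r]]) (auto simp: I_def dist_commute)
  then obtain t q where t: "strict_mono t" "range t \<subseteq> I" "(x \<circ> t) \<longlonglongrightarrow> q"
    using bounded_infinite_imp_convergent_subsequence[OF inf] by blast
  then have tI: "t n \<in> I" for n by blast
  have "(\<lambda>n. dist ((x \<circ> t) n) p) \<longlonglongrightarrow> dist q p" using t(3) by (intro tendsto_intros)
  then have "dist q p \<le> r"
    using tI by (intro LIMSEQ_le_const2) (auto simp: I_def less_imp_le)
  moreover have "(\<lambda>n. dist (x (Suc (t n))) p) \<longlonglongrightarrow> dist q p"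
    using step[OF t(1) t(3)] by (intro tendsto_intros)
  then have "r \<le> dist q p"
    using tI by (intro LIMSEQ_le_const) (auto simp: I_def)
  ultimately have "r = dist p q" by (simp add: dist_commute)
  then show False using r cluster[OF t(1) t(3)] by blast
qed

text \<open>Concavity: the graph of the power lies below its tangent at \<open>a\<close>. This is
  the weighted inequality of arithmetic and geometric means, multiplied by
  \<open>a powr (\<alpha> - 1)\<close>.\<close>

lemma powr_le_tangent:
  fixes a b \<alpha> :: real
  assumes "0 < a" "0 \<le> b" "0 < \<alpha>" "\<alpha> < 1"
  shows "b powr \<alpha> \<le> a powr \<alpha> + \<alpha> * a powr (\<alpha> - 1) * (b - a)"
proof -
  have "b powr \<alpha> * a powr (1 - \<alpha>) \<le> \<alpha> * b + (1 - \<alpha>) * a"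
    using Youngs_inequality_0[of \<alpha> "1 - \<alpha>" b a] assms by (cases "b = 0") auto
  then have "(b powr \<alpha> * a powr (1 - \<alpha>)) * a powr (\<alpha> - 1) \<le> (\<alpha> * b + (1 - \<alpha>) * a) * a powr (\<alpha> - 1)"
    by (intro mult_right_mono) auto
  moreover have "a powr (1 - \<alpha>) * a powr (\<alpha> - 1) = 1"
    using assms by (simp add: powr_add[symmetric])
  moreover have "a * a powr (\<alpha> - 1) = a powr \<alpha>"
    using assms by (simp add: powr_mult_base)
  ultimately show ?thesis by (simp add: algebra_simps)
qed

text \<open>The desingularising function \<open>C / (1 - \<theta>) * e powr (1 - \<theta>)\<close>
  has derivative \<open>C * e powr (- \<theta>)\<close>. By concavity, its decrement bounds the step
  length. When \<open>e k = 0\<close> the descent inequality says nothing, and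
  \<open>stationary\<close> makes the step vanish.\<close>

theorem converges_if_lojasiewicz_descent:
  fixes x :: "nat \<Rightarrow> 'a::metric_space" and e :: "nat \<Rightarrow> real"
  assumes r: "r > 0" and C: "C > 0" and \<theta>: "0 < \<theta>" "\<theta> < 1"
    and nonneg: "\<And>k. 0 \<le> e k" and lim: "e \<longlonglongrightarrow> 0"
    and stationary: "\<And>k. e (Suc k) = e k \<Longrightarrow> x (Suc k) = x k"
    and dec: "\<And>k. e (Suc k) \<le> e k"
    and descent: "\<And>k. dist (x k) p < r \<Longrightarrow>
      e k powr \<theta> * dist (x k) (x (Suc k)) \<le> C * (e k - e (Suc k))"
    and s: "strict_mono s" "(x \<circ> s) \<longlonglongrightarrow> p"
  shows "x \<longlonglongrightarrow> p"
proof (rule converges_to_cluster_point_if_length_controlled[OF r _ _ _ s])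
  define \<phi> where "\<phi> k = C / (1 - \<theta>) * e k powr (1 - \<theta>)" for k
  show "0 \<le> \<phi> k" for k using C \<theta> by (simp add: \<phi>_def)
  have "(\<lambda>k. e k powr (1 - \<theta>)) \<longlonglongrightarrow> 0 powr (1 - \<theta>)"
    using lim \<theta> nonneg by (intro tendsto_powr') auto
  from tendsto_mult_left[OF this, of "C / (1 - \<theta>)"] show "\<phi> \<longlonglongrightarrow> 0"
    by (simp add: \<phi>_def[abs_def])
  fix k assume k: "dist (x k) p < r"
  show "dist (x k) (x (Suc k)) \<le> \<phi> k - \<phi> (Suc k)"
  proof (cases "e k = 0")
    case True
    then have "e (Suc k) = 0" using dec[of k] nonneg[of "Suc k"] by simp
    then show ?thesis using True stationary[of k] by (simp add: \<phi>_def)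
  next
    case False
    then have pos: "e k > 0" using nonneg[of k] by simp
    have "dist (x k) (x (Suc k)) = e k powr (- \<theta>) * (e k powr \<theta> * dist (x k) (x (Suc k)))"
      using pos by (simp add: mult.assoc[symmetric] powr_add[symmetric])
    also have "\<dots> \<le> e k powr (- \<theta>) * (C * (e k - e (Suc k)))"
      using descent[OF k] by (intro mult_left_mono) auto
    also have "\<dots> = C / (1 - \<theta>) * ((1 - \<theta>) * e k powr ((1 - \<theta>) - 1) * (e k - e (Suc k)))"
      using \<theta> by simp
    also have "\<dots> \<le> C / (1 - \<theta>) * (e k powr (1 - \<theta>) - e (Suc k) powr (1 - \<theta>))"
      using powr_le_tangent[OF pos nonneg[of "Suc k"], of "1 - \<theta>"] \<theta> C
      by (intro mult_left_mono) (auto simp: algebra_simps)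
    finally show ?thesis by (simp add: \<phi>_def algebra_simps)
  qed
qed

subsection \<open>The step of the method\<close>

locale bnqn = C3_function f for f :: "real^'n \<Rightarrow> real" +
  fixes \<delta> :: "nat \<Rightarrow> real" and \<tau> \<gamma>0 \<kappa> :: real
  assumes params: "bnqn_params \<delta> \<tau> \<gamma>0 CARD('n)" and tau_le_1: "\<tau> \<le> 1"
    and kappa_eq: "\<kappa> = bnqn_kappa \<delta> CARD('n)"
begin

abbreviation "T \<equiv> bnqn_step \<delta> \<tau> \<gamma>0 f"

abbreviation s_bound :: "real^'n \<Rightarrow> real"
  where "s_bound x \<equiv> \<kappa> * norm (grad f x) powr \<tau>"

lemma tau_pos: "\<tau> > 0" and gamma0: "0 < \<gamma>0" "\<gamma>0 < 1"
  using params by (auto simp: bnqn_params_def)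

lemma kappa_pos: "\<kappa> > 0"
  and kappa_le: "i \<le> CARD('n) \<Longrightarrow> j \<le> CARD('n) \<Longrightarrow> i \<noteq> j \<Longrightarrow> 2 * \<kappa> \<le> \<bar>\<delta> i - \<delta> j\<bar>"
proof -
  let ?S = "{\<bar>\<delta> i - \<delta> j\<bar> | i j. i \<le> CARD('n) \<and> j \<le> CARD('n) \<and> i \<noteq> j}"
  have "?S \<subseteq> (\<lambda>(i, j). \<bar>\<delta> i - \<delta> j\<bar>) ` ({..CARD('n)} \<times> {..CARD('n)})" by auto
  then have fin: "finite ?S" by (rule finite_subset) auto
  \<comment> \<open>Ensures that indices 0 and 1 are both admissible, so the minimum is over a
    nonempty set.\<close>
  have "CARD('n) \<ge> 1" by (simp add: Suc_leI)
  then have "\<bar>\<delta> 0 - \<delta> 1\<bar> \<in> ?S" by force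
  then have "Min ?S \<in> ?S" using fin by (intro Min_in) auto
  moreover have "inj_on \<delta> {0..CARD('n)}" using params by (simp add: bnqn_params_def)
  ultimately show "\<kappa> > 0" by (fastforce simp: kappa_eq bnqn_kappa_def dest: inj_onD)
  assume "i \<le> CARD('n)" "j \<le> CARD('n)" "i \<noteq> j"
  then have "Min ?S \<le> \<bar>\<delta> i - \<delta> j\<bar>" using fin by (intro Min_le) auto
  then show "2 * \<kappa> \<le> \<bar>\<delta> i - \<delta> j\<bar>" by (simp add: kappa_eq bnqn_kappa_def)
qed

text \<open>Each of the at most \<open>CARD('n)\<close> eigenvalues spoils at most one of the
  \<open>CARD('n) + 1\<close> shifts.\<close>

lemma good_shift_exists:
  fixes H :: "real^'n^'n"
  assumes H: "eigenbasis H B l" and s: "s > 0"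
  shows "\<exists>j\<le>CARD('n). \<kappa> * s \<le> minsp (H + (\<delta> j * s) *\<^sub>R mat 1)"
proof (rule ccontr)
  assume "\<not> ?thesis"
  then have "\<exists>b\<in>B. \<bar>l b + \<delta> j * s\<bar> < \<kappa> * s" if "j \<le> CARD('n)" for j
    using eigenbasis.minsp_attained[OF eigenbasis_shift[OF H, of "\<delta> j * s"]] that
    by (metis not_le)
  then obtain b where b: "\<And>j. j \<le> CARD('n) \<Longrightarrow> b j \<in> B \<and> \<bar>l (b j) + \<delta> j * s\<bar> < \<kappa> * s"
    by metis
  have "card (b ` {..CARD('n)}) \<le> card B"
    using b eigenbasis.finite_B[OF H] by (intro card_mono) auto
  then have "card (b ` {..CARD('n)}) < card {..CARD('n)}"
    using eigenbasis.card_B[OF H] by simp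
  then obtain i j where ij: "i \<le> CARD('n)" "j \<le> CARD('n)" "i \<noteq> j" "b i = b j"
    using pigeonhole[of b "{..CARD('n)}"] by (auto simp: inj_on_def)
  have "\<bar>\<delta> i * s - \<delta> j * s\<bar> < 2 * \<kappa> * s"
    using b[OF ij(1)] b[OF ij(2)] ij(4) by auto
  moreover have "\<bar>\<delta> i * s - \<delta> j * s\<bar> = \<bar>\<delta> i - \<delta> j\<bar> * s"
    using s by (simp add: left_diff_distrib[symmetric] abs_mult)
  ultimately show False using kappa_le[OF ij(1,2,3)] s by simp
qed

text \<open>Collects what later arguments use about one step, with \<open>w\<close> the direction
  before normalisation and \<open>\<gamma>\<close> the step size found by backtracking.
  \<open>D\<close> bounds the shifts, \<open>L\<close> is the constant of the quadratic upper bound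
  for \<open>f\<close>, and \<open>M\<close> bounds the shifted Hessian.\<close>

definition is_step :: "real \<Rightarrow> real \<Rightarrow> real \<Rightarrow> real^'n \<Rightarrow> real^'n \<Rightarrow> real \<Rightarrow> bool" where
  "is_step D L M x w \<gamma> \<longleftrightarrow>
      T x = x - \<gamma> *\<^sub>R (w /\<^sub>R max 1 (norm w)) \<and> 0 < \<gamma> \<and> \<gamma> \<le> 1 \<and>
      min \<gamma>0 (2 * s_bound x / (9 * L)) \<le> \<gamma> \<and>
      f (T x) - f x \<le> - \<gamma> * ((w /\<^sub>R max 1 (norm w)) \<bullet> grad f x) / 3 \<and>
      s_bound x * (norm w)\<^sup>2 \<le> w \<bullet> grad f x \<and>
      norm w \<le> norm (grad f x) / s_bound x \<and>
      norm (hess f x *v w) \<le> norm (grad f x) + D * norm (grad f x) powr \<tau> * norm w \<and>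
      (norm (grad f x))\<^sup>2 \<le> M * (w \<bullet> grad f x)"

lemma is_stepD:
  assumes "is_step D L M x w \<gamma>"
  shows "T x = x - \<gamma> *\<^sub>R (w /\<^sub>R max 1 (norm w))" "0 < \<gamma>" "\<gamma> \<le> 1"
    "min \<gamma>0 (2 * s_bound x / (9 * L)) \<le> \<gamma>"
    "f (T x) - f x \<le> - \<gamma> * ((w /\<^sub>R max 1 (norm w)) \<bullet> grad f x) / 3"
    "s_bound x * (norm w)\<^sup>2 \<le> w \<bullet> grad f x"
    "norm w \<le> norm (grad f x) / s_bound x"
    "norm (hess f x *v w) \<le> norm (grad f x) + D * norm (grad f x) powr \<tau> * norm w"
    "(norm (grad f x))\<^sup>2 \<le> M * (w \<bullet> grad f x)"
  using assms unfolding is_step_def by blast+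

text \<open>The constants depend on the ball only, while \<open>w\<close> and
  \<open>\<gamma>\<close> depend on \<open>x\<close>. This uniformity is what the limit arguments
  need.\<close>

lemma step_bounds:
  "\<exists>D>0. \<exists>L>0. \<exists>M>0. \<forall>x\<in>cball 0 R. grad f x \<noteq> 0 \<longrightarrow>
    (\<exists>w \<gamma>. is_step D L M x w \<gamma>)"
proof -
  obtain K where K: "K > 0" "\<And>x v. x \<in> cball 0 R \<Longrightarrow> norm (hess f x *v v) \<le> K * norm v"
    using hess_bounded by blast
  obtain L where L: "L > 0" "\<And>x h. x \<in> cball 0 R \<Longrightarrow> norm h \<le> 1 \<Longrightarrow>
      f (x + h) - f x \<le> h \<bullet> grad f x + L * (norm h)\<^sup>2"
    using descent by blast
  have "bounded (grad f ` cball 0 R)"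
    by (intro compact_imp_bounded compact_continuous_image continuous_at_imp_continuous_on)
      (auto intro: isCont_grad)
  then obtain G where G: "\<And>x. x \<in> cball 0 R \<Longrightarrow> norm (grad f x) \<le> G"
    unfolding bounded_iff by blast
  define D where "D = 1 + (\<Sum>j\<le>CARD('n). \<bar>\<delta> j\<bar>)"
  have D0: "D > 0" unfolding D_def by (intro add_pos_nonneg sum_nonneg) auto
  have D: "\<bar>\<delta> j\<bar> \<le> D" if "j \<le> CARD('n)" for j
    using member_le_sum[of j "{..CARD('n)}" "\<lambda>j. \<bar>\<delta> j\<bar>"] that by (simp add: D_def)
  \<comment> \<open>\<open>K\<close> accounts for the Hessian and \<open>D * G powr \<tau>\<close>
    for the largest shift on the ball.\<close>
  define M where "M = K + D * G powr \<tau>"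
  have M: "M > 0" unfolding M_def using K D0 by (intro add_pos_nonneg mult_nonneg_nonneg) auto
  have main: "\<exists>w \<gamma>. is_step D L M x w \<gamma>"
    if x: "x \<in> cball 0 R" and g0: "grad f x \<noteq> 0" for x
  proof -
    define g where "g = grad f x"
    define a where "a = norm g powr \<tau>"
    define s where "s = \<kappa> * a"
    have a: "a > 0" using g0 by (simp add: a_def g_def)
    have s: "s > 0" using kappa_pos a by (simp add: s_def)
    obtain B l where H: "eigenbasis (hess f x) B l"
      using symmetric_eigenbasis hess_symmetric by metis
    \<comment> \<open>Here and below, \<open>j\<close>, \<open>A\<close>, \<open>wh\<close> and
      \<open>n\<close> repeat the local bindings of \<open>bnqn_step\<close>, so that
      \<open>T x\<close> unfolds to them.\<close>
    define j where "j = (LEAST j. j \<le> CARD('n) \<and> \<kappa> * norm g powr \<tau> \<le> minsp (hess f x + (\<delta> j * norm g powr \<tau>) *\<^sub>R mat 1))"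
    define A where "A = hess f x + (\<delta> j * norm g powr \<tau>) *\<^sub>R mat 1"
    have j: "j \<le> CARD('n)" "s \<le> minsp A"
      using LeastI_ex[OF good_shift_exists[OF H a]] unfolding j_def[symmetric] a_def A_def s_def
      by (auto simp: j_def)
    interpret A: eigenbasis A B "\<lambda>b. l b + \<delta> j * norm g powr \<tau>"
      unfolding A_def by (rule eigenbasis_shift[OF H])
    define w where "w = w_dir A g"
    define wh where "wh = w /\<^sub>R max 1 (norm w)"
    define n where "n = (LEAST n::nat. f (x - (\<gamma>0 / 3 ^ n) *\<^sub>R wh) - f x \<le> - (\<gamma>0 / 3 ^ n) * (wh \<bullet> g) / 3)"
    have T: "T x = x - (\<gamma>0 / 3 ^ n) *\<^sub>R wh"
      using g0 unfolding bnqn_step_def Let_def n_def wh_def w_def w_dir_def A_def j_def g_def kappa_eq by simp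
    have w1: "s * (norm w)\<^sup>2 \<le> w \<bullet> g" unfolding w_def by (rule A.w_dir_inner_ge[OF s j(2)])
    have w2: "norm w \<le> norm g / s" unfolding w_def by (rule A.norm_w_dir_le[OF s j(2)])
    have Av: "A *v v = hess f x *v v + (\<delta> j * a) *\<^sub>R v" for v
      by (simp add: A_def a_def matrix_vector_mult_add_rdistrib scaleR_matrix_vector_assoc[symmetric])
    have ja: "\<bar>\<delta> j * a\<bar> \<le> D * a" using D[OF j(1)] a by (simp add: abs_mult)
    have w3: "norm (hess f x *v w) \<le> norm g + D * a * norm w"
    proof -
      have "hess f x *v w = A *v w - (\<delta> j * a) *\<^sub>R w" by (simp add: Av)
      also have "norm \<dots> \<le> norm (A *v w) + norm ((\<delta> j * a) *\<^sub>R w)" by (rule norm_triangle_ineq4)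
      also have "norm (A *v w) = norm g" unfolding w_def by (rule A.norm_A_w_dir[OF s j(2)])
      also have "norm ((\<delta> j * a) *\<^sub>R w) \<le> D * a * norm w"
        unfolding norm_scaleR using ja by (intro mult_right_mono) auto
      finally show ?thesis by simp
    qed
    have w4: "(norm g)\<^sup>2 \<le> M * (w \<bullet> g)"
      unfolding w_def
    proof (rule A.norm_le_w_dir_inner[OF s j(2)])
      fix v
      have "norm (A *v v) \<le> K * norm v + D * a * norm v"
        unfolding Av using K(2)[OF x, of v] ja
        by (intro order_trans[OF norm_triangle_ineq] add_mono) (auto intro: mult_right_mono)
      also have "\<dots> \<le> M * norm v"
      proof -
        have "a \<le> G powr \<tau>" unfolding a_def g_def using G[OF x] tau_pos by (intro powr_mono2) auto
        then have "D * a \<le> D * G powr \<tau>" using D0 by simp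
        then have "K + D * a \<le> M" by (simp add: M_def)
        from mult_right_mono[OF this, of "norm v"] show ?thesis by (simp add: distrib_right)
      qed
      finally show "norm (A *v v) \<le> M * norm v" .
    qed
    have wg: "0 \<le> w \<bullet> g" using w1 s by (smt (verit) mult_nonneg_nonneg zero_le_power2)
    have nwh: "norm wh \<le> 1" unfolding wh_def by (simp add: field_simps)
    \<comment> \<open>Normalising divides the left side of \<open>w1\<close> by
      \<open>c\<^sup>2\<close> but the right side only by \<open>c \<ge> 1\<close>, so the
      inequality survives.\<close>
    have whg: "s * (norm wh)\<^sup>2 \<le> wh \<bullet> g"
    proof -
      define c where "c = max 1 (norm w)"
      have c: "c \<ge> 1" by (simp add: c_def)
      have "s * (norm wh)\<^sup>2 = (s * (norm w)\<^sup>2) / c\<^sup>2"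
        using c by (simp add: wh_def c_def[symmetric] power_mult_distrib power_divide divide_simps)
      also have "\<dots> \<le> (w \<bullet> g) / c\<^sup>2" using w1 by (intro divide_right_mono) auto
      also have "\<dots> \<le> (w \<bullet> g) / c"
        using wg c by (intro divide_left_mono) (auto simp: power2_eq_square)
      also have "\<dots> = wh \<bullet> g" by (simp add: wh_def c_def[symmetric] divide_inverse mult.commute)
      finally show ?thesis .
    qed
    \<comment> \<open>For \<open>t\<close> up to \<open>2 * s / (3 * L)\<close> the quadratic error
      uses up at most two thirds of the linear decrease, which leaves the required third.\<close>
    have armijo: "f (x - t *\<^sub>R wh) - f x \<le> - t * (wh \<bullet> g) / 3"
      if t: "0 < t" "t \<le> 1" "t \<le> 2 * s / (3 * L)" for t
    proof -
      have "norm (- t *\<^sub>R wh) \<le> 1" using t nwh by (simp add: mult_le_one)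
      from L(2)[OF x this]
      have "f (x - t *\<^sub>R wh) - f x \<le> - t * (wh \<bullet> g) + t * (L * t * (norm wh)\<^sup>2)"
        by (simp add: g_def power2_eq_square algebra_simps)
      also have "L * t * (norm wh)\<^sup>2 \<le> (2 / 3 * s) * (norm wh)\<^sup>2"
        using t(3) L(1) by (intro mult_right_mono) (auto simp: field_simps)
      also have "\<dots> \<le> 2 / 3 * (wh \<bullet> g)" using whg by simp
      finally show ?thesis using t by (simp add: algebra_simps)
    qed
    have small: "0 < \<gamma>0 / 3 ^ k" "\<gamma>0 / 3 ^ k \<le> 1" for k
    proof -
      show "0 < \<gamma>0 / 3 ^ k" using gamma0 by simp
      have "(1::real) \<le> 3 ^ k" by simp
      then have "\<gamma>0 \<le> 3 ^ k" using gamma0 by linarith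
      then show "\<gamma>0 / 3 ^ k \<le> 1" by simp
    qed
    have "2 * s / (3 * L) > 0" using s L by simp
    moreover have "(\<lambda>k. \<gamma>0 * (1 / 3) ^ k) \<longlonglongrightarrow> \<gamma>0 * 0"
      by (intro tendsto_intros LIMSEQ_power_zero) simp
    ultimately have "eventually (\<lambda>k. \<gamma>0 * (1 / 3) ^ k < 2 * s / (3 * L)) sequentially"
      by (intro order_tendstoD) auto
    then obtain k where "\<gamma>0 / 3 ^ k < 2 * s / (3 * L)"
      using eventually_happens'[OF sequentially_bot] by (fastforce simp: power_one_over)
    then have "\<exists>n. f (x - (\<gamma>0 / 3 ^ n) *\<^sub>R wh) - f x \<le> - (\<gamma>0 / 3 ^ n) * (wh \<bullet> g) / 3"
      using armijo[OF small, of k] by (intro exI[of _ k]) simp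
    from LeastI_ex[OF this] have dec: "f (T x) - f x \<le> - (\<gamma>0 / 3 ^ n) * (wh \<bullet> g) / 3"
      unfolding T n_def .
    \<comment> \<open>Either the first trial \<open>\<gamma>0\<close> is accepted, or the previous
      trial, three times as long, failed and so exceeded \<open>2 * s / (3 * L)\<close>.\<close>
    have "min \<gamma>0 (2 * s / (9 * L)) \<le> \<gamma>0 / 3 ^ n"
    proof (cases n)
      case (Suc k)
      then have "\<not> f (x - (\<gamma>0 / 3 ^ k) *\<^sub>R wh) - f x \<le> - (\<gamma>0 / 3 ^ k) * (wh \<bullet> g) / 3"
        unfolding n_def by (intro not_less_Least) (simp add: n_def)
      then have "\<not> \<gamma>0 / 3 ^ k \<le> 2 * s / (3 * L)" using armijo[OF small] by blast
      then have "2 * s / (9 * L) \<le> \<gamma>0 / 3 ^ n" using L Suc by (simp add: field_simps)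
      then show ?thesis by simp
    qed simp
    then show ?thesis
      using T small[of n] dec w1 w2 w3 w4
      by (intro exI[of _ w] exI[of _ "\<gamma>0 / 3 ^ n"]) (simp add: is_step_def wh_def s_def a_def g_def)
  qed
  show ?thesis
    by (rule exI[of _ D], rule conjI[OF D0], rule exI[of _ L], rule conjI[OF L(1)],
        rule exI[of _ M], rule conjI[OF M]) (intro ballI impI main)
qed

end

section \<open>Decrease along one step, and continuity of the step map at critical points\<close>

context bnqn
begin

lemma step_critical: "grad f x = 0 \<Longrightarrow> T x = x"
  by (simp add: bnqn_step_def)

lemma s_bound_pos: "grad f x \<noteq> 0 \<Longrightarrow> s_bound x > 0"
  using kappa_pos by simp

text \<open>With \<open>g\<close> the gradient, \<open>s_bound x * norm w \<le> norm g\<close> and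
  \<open>(norm g)\<^sup>2 \<le> M * (w \<bullet> g)\<close> give the bound for the raw direction.
  The step size and the normalisation scale the length and the guaranteed decrease alike; the 3 in
  the constant \<open>\<kappa> / (3 * M)\<close> is that of the line search.\<close>

lemma descent_dominates_length:
  "\<exists>c>0. \<forall>x\<in>cball 0 R. c * norm (grad f x) powr (1 + \<tau>) * norm (T x - x) \<le> f x - f (T x)"
proof -
  obtain D L M where M: "M > 0"
    and step: "\<And>x. x \<in> cball 0 R \<Longrightarrow> grad f x \<noteq> 0 \<Longrightarrow> \<exists>w \<gamma>. is_step D L M x w \<gamma>"
    using step_bounds[of R] by blast
  have "\<kappa> / (3 * M) * norm (grad f x) powr (1 + \<tau>) * norm (T x - x) \<le> f x - f (T x)"
    if x: "x \<in> cball 0 R" for x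
  proof (cases "grad f x = 0")
    case False
    define g where "g = grad f x"
    obtain w \<gamma> where "is_step D L M x w \<gamma>" using step[OF x False] by blast
    note st = is_stepD[OF this, folded g_def]
    note Tx = st(1) and \<gamma> = st(2) and dec = st(5) and w = st(7) and wg = st(9)
    define c where "c = max 1 (norm w)"
    have c: "c > 0" by (simp add: c_def)
    have "s_bound x * norm w \<le> norm g"
      using w s_bound_pos[OF False] by (simp add: g_def field_simps)
    then have "norm g * (s_bound x * norm w) \<le> norm g * norm g"
      by (intro mult_left_mono) auto
    also have "\<dots> \<le> M * (w \<bullet> g)" using wg by (simp add: power2_eq_square)
    also have "norm g * (s_bound x * norm w) = \<kappa> * norm g powr (1 + \<tau>) * norm w"
      using False by (simp add: g_def powr_add)
    finally have 1: "\<kappa> * norm g powr (1 + \<tau>) * norm w \<le> M * (w \<bullet> g)" .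
    have "norm (T x - x) = \<gamma> * (norm w / c)"
      using \<gamma> c by (simp add: Tx c_def[symmetric] divide_inverse mult.commute)
    then have "\<kappa> / (3 * M) * norm g powr (1 + \<tau>) * norm (T x - x)
        = \<gamma> / (3 * M * c) * (\<kappa> * norm g powr (1 + \<tau>) * norm w)"
      using M c by (simp add: field_simps)
    also have "\<dots> \<le> \<gamma> / (3 * M * c) * (M * (w \<bullet> g))"
      using 1 \<gamma> M c by (intro mult_left_mono) auto
    also have "\<dots> = \<gamma> * ((w /\<^sub>R c) \<bullet> g) / 3"
      using M c by (simp add: field_simps)
    also have "\<dots> \<le> f x - f (T x)" using dec by (simp add: c_def)
    finally show ?thesis by (simp add: g_def)
  qed (simp add: step_critical)
  then show ?thesis
    using M kappa_pos by (intro exI[of _ "\<kappa> / (3 * M)"]) auto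
qed

lemma step_descent: "f (T x) \<le> f x"
  and step_stationary: "f (T x) = f x \<Longrightarrow> T x = x"
proof -
  obtain c where c: "c > 0" "c * norm (grad f x) powr (1 + \<tau>) * norm (T x - x) \<le> f x - f (T x)"
    using descent_dominates_length[of "norm x"] by auto
  moreover have "0 \<le> c * norm (grad f x) powr (1 + \<tau>) * norm (T x - x)" using c by simp
  ultimately show "f (T x) \<le> f x" by linarith
  assume "f (T x) = f x"
  then have "c * norm (grad f x) powr (1 + \<tau>) * norm (T x - x) \<le> 0" using c by simp
  then have "grad f x = 0 \<or> T x = x"
    using c(1) by (auto simp: mult_le_0_iff)
  then show "T x = x" using step_critical by blast
qed

text \<open>Near \<open>q\<close> the decrease is at least \<open>\<psi>\<close>, which is
  continuous and positive at \<open>q\<close>.\<close>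

lemma descent_not_null_at_noncritical:
  assumes y: "y \<longlonglongrightarrow> q" and q: "grad f q \<noteq> 0"
  shows "\<not> (\<lambda>n. f (y n) - f (T (y n))) \<longlonglongrightarrow> 0"
proof
  assume null: "(\<lambda>n. f (y n) - f (T (y n))) \<longlonglongrightarrow> 0"
  obtain R where R: "\<And>n. y n \<in> cball 0 R"
    using convergent_imp_bounded[OF y] unfolding bounded_iff by auto
  obtain D L M where L: "L > 0" and M: "M > 0"
    and step: "\<And>x. x \<in> cball 0 R \<Longrightarrow> grad f x \<noteq> 0 \<Longrightarrow> \<exists>w \<gamma>. is_step D L M x w \<gamma>"
    using step_bounds[of R] by blast
  \<comment> \<open>The guaranteed decrease with \<open>\<gamma>\<close>,
    \<open>w \<bullet> grad f x\<close> and \<open>norm w\<close> replaced by their bounds, so that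
    only the gradient enters.\<close>
  define \<psi> where "\<psi> x = min \<gamma>0 (2 * s_bound x / (9 * L)) *
    (((norm (grad f x))\<^sup>2 / M) / max 1 (norm (grad f x) / s_bound x)) / 3" for x
  have lower: "\<psi> x \<le> f x - f (T x)" if x: "x \<in> cball 0 R" "grad f x \<noteq> 0" for x
  proof -
    define g where "g = grad f x"
    obtain w \<gamma> where "is_step D L M x w \<gamma>" using step[OF x] by blast
    note st = is_stepD[OF this, folded g_def]
    note \<gamma> = st(2,4) and dec = st(5) and w = st(7) and wg = st(9)
    have 1: "(norm g)\<^sup>2 / M \<le> w \<bullet> g" using wg M by (simp add: field_simps)
    have 0: "0 \<le> (norm g)\<^sup>2 / M" using M by simp
    have 2: "0 \<le> w \<bullet> g" using 0 1 by linarith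
    have "\<psi> x \<le> \<gamma> * ((w \<bullet> g) / max 1 (norm w)) / 3"
      unfolding \<psi>_def g_def[symmetric]
      using \<gamma> 0 1 2 w M
      by (intro divide_right_mono mult_mono frac_le)
        (auto intro!: divide_nonneg_nonneg mult_nonneg_nonneg simp: le_max_iff_disj)
    also have "\<dots> = \<gamma> * ((w /\<^sub>R max 1 (norm w)) \<bullet> g) / 3"
      unfolding inner_scaleR_left divide_inverse by (simp only: ac_simps)
    also have "\<dots> \<le> f x - f (T x)" using dec by simp
    finally show ?thesis .
  qed
  have lim: "(\<lambda>n. grad f (y n)) \<longlonglongrightarrow> grad f q" by (rule isCont_tendsto_compose[OF isCont_grad y])
  have s0: "s_bound q \<noteq> 0" using s_bound_pos[OF q] by (metis less_irrefl)
  have "(\<lambda>n. \<psi> (y n)) \<longlonglongrightarrow> \<psi> q"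
    unfolding \<psi>_def using lim q s0 L M by (intro tendsto_intros) auto
  moreover have "eventually (\<lambda>n. grad f (y n) \<noteq> 0) sequentially"
    using tendsto_imp_eventually_ne[OF lim q] .
  then have "eventually (\<lambda>n. \<psi> (y n) \<le> f (y n) - f (T (y n))) sequentially"
    by eventually_elim (use lower R in auto)
  ultimately have "\<psi> q \<le> 0"
    using null by (intro tendsto_le[OF sequentially_bot])
  moreover have "\<psi> q > 0"
    unfolding \<psi>_def using q s_bound_pos[OF q] gamma0 L M by simp
  ultimately show False by simp
qed

text \<open>By symmetry of the Hessian, the gradient of the pairing at \<open>(x, y)\<close> is the
  pair of \<open>hess f x *v y\<close> and \<open>grad f x\<close>.\<close>

lemma norm_grad_pairing:
  "norm (grad (\<lambda>z::(real^'n) \<times> (real^'n). grad f (fst z) \<bullet> snd z) (x, y))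
    \<le> norm (hess f x *v y) + norm (grad f x)"
proof -
  have "((\<lambda>z::(real^'n) \<times> (real^'n). grad f (fst z) \<bullet> snd z) has_derivative
      (\<lambda>h. grad f (fst (x, y)) \<bullet> snd h + (hess f x *v fst h) \<bullet> snd (x, y))) (at (x, y))"
    by (intro has_derivative_inner has_derivative_snd has_derivative_ident
        has_derivative_compose[of fst fst "(x, y)" UNIV "grad f" "\<lambda>h. hess f x *v h", simplified]
        has_derivative_fst has_derivative_hess)
  also have "(\<lambda>h. grad f (fst (x, y)) \<bullet> snd h + (hess f x *v fst h) \<bullet> snd (x, y))
      = (\<lambda>h. h \<bullet> (hess f x *v y, grad f x))"
    by (rule ext) (simp add: inner_prod_def hess_symmetric[of x _ y] inner_commute[of "grad f x"])
  finally have "grad (\<lambda>z::(real^'n) \<times> (real^'n). grad f (fst z) \<bullet> snd z) (x, y) = (hess f x *v y, grad f x)"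
    by (rule grad_eqI)
  then show ?thesis by (simp add: norm_Pair_le)
qed

lemma is_step_length:
  assumes "is_step D L M x w \<gamma>"
  shows "norm (T x - x) \<le> norm w"
proof -
  note st = is_stepD(1-3)[OF assms]
  have "norm (T x - x) = \<gamma> * (norm w / max 1 (norm w))"
    using st by (simp add: divide_inverse mult.commute)
  also have "\<dots> \<le> 1 * (norm w / 1)" using st by (intro mult_mono divide_left_mono) auto
  finally show ?thesis by simp
qed

text \<open>The direction is at most \<open>norm g / s_bound\<close>, a multiple of
  \<open>norm g powr (1 - \<tau>)\<close> with positive exponent.\<close>

lemma step_continuous_at_critical_lt_1:
  assumes \<tau>: "\<tau> < 1" and y: "y \<longlonglongrightarrow> p" and p: "grad f p = 0"
  shows "(\<lambda>n. T (y n)) \<longlonglongrightarrow> p"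
proof -
  obtain R where R: "\<And>n. y n \<in> cball 0 R"
    using convergent_imp_bounded[OF y] unfolding bounded_iff by auto
  have "norm (T x - x) \<le> norm (grad f x) powr (1 - \<tau>) / \<kappa>" if x: "x \<in> cball 0 R" for x
  proof (cases "grad f x = 0")
    case False
    then obtain D L M w \<gamma> where st: "is_step D L M x w \<gamma>"
      using step_bounds[of R] x by blast
    have "norm (T x - x) \<le> norm (grad f x) / s_bound x"
      using is_step_length[OF st] is_stepD(7)[OF st] by simp
    also have "\<dots> = norm (grad f x) powr (1 - \<tau>) / \<kappa>"
      using False by (simp add: powr_diff)
    finally show ?thesis .
  qed (simp add: step_critical)
  then have bd: "norm (T (y n) - y n) \<le> norm (grad f (y n)) powr (1 - \<tau>) / \<kappa>" for n
    using R by blast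
  have "(\<lambda>n. grad f (y n)) \<longlonglongrightarrow> 0"
    using isCont_tendsto_compose[OF isCont_grad y] p by simp
  then have "(\<lambda>n. norm (grad f (y n)) powr (1 - \<tau>)) \<longlonglongrightarrow> 0 powr (1 - \<tau>)"
    using \<tau> by (intro tendsto_powr' tendsto_norm_zero tendsto_const) auto
  then have "(\<lambda>n. norm (grad f (y n)) powr (1 - \<tau>) / \<kappa>) \<longlonglongrightarrow> 0"
    by (simp add: tendsto_divide_zero)
  then have "(\<lambda>n. T (y n) - y n) \<longlonglongrightarrow> 0"
    by (rule Lim_null_comparison[rotated]) (simp add: bd)
  from tendsto_add[OF this y] show ?thesis by simp
qed

text \<open>For \<open>\<tau> = 1\<close> the directions are only known to be bounded by
  \<open>1 / \<kappa>\<close>. If steps of length at least \<open>\<epsilon>\<close> recurred, their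
  directions would cluster at some \<open>v\<close>, and the inequality for the pairing at
  \<open>(p, v)\<close>, where the pairing is zero, would force these directions to 0.\<close>

lemma step_continuous_at_critical_eq_1:
  assumes \<tau>: "\<tau> = 1" and loj: "grad_loj f" and y: "y \<longlonglongrightarrow> p" and p: "grad f p = 0"
  shows "(\<lambda>n. T (y n)) \<longlonglongrightarrow> p"
proof -
  obtain R where R: "\<And>n. y n \<in> cball 0 R"
    using convergent_imp_bounded[OF y] unfolding bounded_iff by auto
  obtain D L M where D: "D > 0"
    and step: "\<And>x. x \<in> cball 0 R \<Longrightarrow> grad f x \<noteq> 0 \<Longrightarrow> \<exists>w \<gamma>. is_step D L M x w \<gamma>"
    using step_bounds[of R] by blast
  have lim: "(\<lambda>n. grad f (y n)) \<longlonglongrightarrow> 0"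
    using isCont_tendsto_compose[OF isCont_grad y] p by simp
  have "(\<lambda>n. T (y n) - y n) \<longlonglongrightarrow> 0"
  proof (rule ccontr)
    assume "\<not> ?thesis"
    then obtain \<epsilon> where \<epsilon>: "\<epsilon> > 0" and far: "\<And>N. \<exists>n\<ge>N. \<epsilon> \<le> norm (T (y n) - y n)"
      unfolding LIMSEQ_iff by (metis diff_zero not_less)
    define I where "I = {n. \<epsilon> \<le> norm (T (y n) - y n)}"
    have inf: "infinite I" using far by (auto simp: I_def infinite_nat_iff_unbounded_le)
    have ne: "grad f (y n) \<noteq> 0" if "n \<in> I" for n
      using that \<epsilon> step_critical[of "y n"] by (auto simp: I_def)
    have "\<exists>w \<gamma>. is_step D L M (y n) w \<gamma>" if "n \<in> I" for n
      using step[OF R ne[OF that]] .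
    then obtain w \<gamma> where st: "\<And>n. n \<in> I \<Longrightarrow> is_step D L M (y n) (w n) (\<gamma> n)"
      by metis
    have w1: "norm (T (y n) - y n) \<le> norm (w n)"
      and w2: "\<kappa> * norm (grad f (y n)) * (norm (w n))\<^sup>2 \<le> w n \<bullet> grad f (y n)"
      and w3: "norm (w n) \<le> 1 / \<kappa>"
      and w4: "norm (hess f (y n) *v w n)
          \<le> norm (grad f (y n)) + D * norm (grad f (y n)) * norm (w n)" if "n \<in> I" for n
      using is_step_length[OF st[OF that]] is_stepD(6-8)[OF st[OF that]] ne[OF that]
      by (simp_all add: \<tau>)
    have "bounded (w ` I)" unfolding bounded_iff using w3 by blast
    then obtain t v where t: "strict_mono t" "range t \<subseteq> I" "(w \<circ> t) \<longlonglongrightarrow> v"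
      using bounded_infinite_imp_convergent_subsequence[OF inf] by blast
    have tI: "t n \<in> I" for n using t(2) by blast
    let ?F = "\<lambda>z::(real^'n) \<times> (real^'n). grad f (fst z) \<bullet> snd z"
    have "loj_at ?F (p, v)" using loj by (simp add: grad_loj_def)
    then obtain U \<mu> C where U: "open U" "(p, v) \<in> U" and \<mu>: "0 < \<mu>" "\<mu> < 1" and C: "C > 0"
      and ineq: "\<And>z. z \<in> U \<Longrightarrow> \<bar>?F z - ?F (p, v)\<bar> powr \<mu> \<le> C * norm (grad ?F z)"
      unfolding loj_at_def by blast
    \<comment> \<open>The gradient of the pairing has norm at most
      \<open>(2 + D / \<kappa>) * norm g\<close>: one \<open>norm g\<close> from each component, and
      the shift term with \<open>norm w \<le> 1 / \<kappa>\<close>.\<close>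
    define C' where "C' = C * (2 + D / \<kappa>)"
    have C': "C' > 0" using C D kappa_pos by (simp add: C'_def add_pos_pos)
    have yt: "(\<lambda>n. y (t n)) \<longlonglongrightarrow> p" using LIMSEQ_subseq_LIMSEQ[OF y t(1)] by (simp add: o_def)
    have "(\<lambda>n. (y (t n), w (t n))) \<longlonglongrightarrow> (p, v)"
      using yt t(3) by (intro tendsto_Pair) (auto simp: o_def)
    then have "eventually (\<lambda>n. (y (t n), w (t n)) \<in> U) sequentially"
      using U by (rule topological_tendstoD)
    moreover have "\<epsilon>\<^sup>2 \<le> C' powr (1 / \<mu>) / \<kappa> * norm (grad f (y (t n))) powr (1 / \<mu> - 1)"
      if inU: "(y (t n), w (t n)) \<in> U" for n
    proof -
      define g where "g = grad f (y (t n))"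
      define u where "u = w (t n)"
      have g: "norm g > 0" using ne[OF tI] by (simp add: g_def)
      have gu: "\<kappa> * norm g * (norm u)\<^sup>2 \<le> u \<bullet> g" using w2[OF tI[of n]] by (simp add: g_def u_def)
      then have ug: "0 \<le> u \<bullet> g"
        using kappa_pos by (smt (verit) mult_nonneg_nonneg norm_ge_zero zero_le_power2)
      have "(u \<bullet> g) powr \<mu> \<le> C * norm (grad ?F (y (t n), w (t n)))"
        using ineq[OF inU] ug p by (simp add: g_def u_def inner_commute)
      also have "\<dots> \<le> C * (norm (hess f (y (t n)) *v u) + norm g)"
        using norm_grad_pairing[of "y (t n)" "w (t n)"] C by (simp add: g_def u_def)
      also have "\<dots> \<le> C * ((norm g + D * norm g * (1 / \<kappa>)) + norm g)"
      proof -
        have "D * norm g * norm u \<le> D * norm g * (1 / \<kappa>)"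
          using w3[OF tI[of n]] D by (intro mult_left_mono) (auto simp: u_def)
        then show ?thesis using w4[OF tI[of n]] C by (simp add: g_def u_def)
      qed
      also have "\<dots> = C' * norm g" by (simp add: C'_def algebra_simps)
      finally have "((u \<bullet> g) powr \<mu>) powr (1 / \<mu>) \<le> (C' * norm g) powr (1 / \<mu>)"
        using \<mu> by (intro powr_mono2) auto
      then have "u \<bullet> g \<le> C' powr (1 / \<mu>) * norm g powr (1 / \<mu>)"
        using \<mu> ug C' by (simp add: powr_powr powr_mult)
      with gu have "\<kappa> * norm g * (norm u)\<^sup>2 \<le> C' powr (1 / \<mu>) * norm g powr (1 / \<mu>)" by linarith
      then have "(norm u)\<^sup>2 \<le> C' powr (1 / \<mu>) / \<kappa> * norm g powr (1 / \<mu> - 1)"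
        using g kappa_pos by (simp add: powr_diff field_simps)
      moreover have "\<epsilon> \<le> norm u"
        using tI[of n] w1[OF tI[of n]] by (simp add: I_def u_def)
      then have "\<epsilon>\<^sup>2 \<le> (norm u)\<^sup>2" using \<epsilon> by (intro power_mono) auto
      ultimately show ?thesis by (simp add: g_def)
    qed
    ultimately have "eventually (\<lambda>n. \<epsilon>\<^sup>2 \<le> C' powr (1 / \<mu>) / \<kappa> * norm (grad f (y (t n))) powr (1 / \<mu> - 1)) sequentially"
      by (rule eventually_mono)
    moreover have "(\<lambda>n. norm (grad f (y (t n)))) \<longlonglongrightarrow> 0"
      using LIMSEQ_subseq_LIMSEQ[OF lim t(1)] by (intro tendsto_norm_zero) (simp add: o_def)
    \<comment> \<open>The exponent is positive because \<open>\<mu> < 1\<close>.\<close>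
    then have "(\<lambda>n. norm (grad f (y (t n))) powr (1 / \<mu> - 1)) \<longlonglongrightarrow> 0 powr (1 / \<mu> - 1)"
      using \<mu> by (intro tendsto_powr' tendsto_const) auto
    from tendsto_mult_left[OF this, of "C' powr (1 / \<mu>) / \<kappa>"]
    have "(\<lambda>n. C' powr (1 / \<mu>) / \<kappa> * norm (grad f (y (t n))) powr (1 / \<mu> - 1)) \<longlonglongrightarrow> 0" by simp
    ultimately have "\<epsilon>\<^sup>2 \<le> 0" by (intro tendsto_le[OF sequentially_bot _ tendsto_const])
    then show False using \<epsilon> by simp
  qed
  from tendsto_add[OF this y] show ?thesis by simp
qed

end

section \<open>Cluster points and convergence of the iterates\<close>

locale bnqn_sequence = bnqn f for f :: "real^'n \<Rightarrow> real" +
  fixes x :: "nat \<Rightarrow> real^'n"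
  assumes seq: "x (Suc k) = T (x k)"
begin

lemma decseq_f: "decseq (\<lambda>k. f (x k))"
  by (rule decseq_SucI) (simp add: seq step_descent)

text \<open>Monotonicity extends the limit of \<open>f\<close> from the subsequence to all iterates.
  The decreases then tend to 0, which is impossible near a noncritical point.\<close>

lemma
  assumes s: "strict_mono s" "(x \<circ> s) \<longlonglongrightarrow> q"
  shows cluster_value: "(\<lambda>k. f (x k)) \<longlonglongrightarrow> f q"
    and cluster_value_le: "f q \<le> f (x k)"
    and cluster_critical: "grad f q = 0"
proof -
  have sub: "(\<lambda>n. f (x (s n))) \<longlonglongrightarrow> f q"
    using isCont_tendsto_compose[OF isCont_f s(2)] by (simp add: o_def)
  show le: "f q \<le> f (x k)" for k
  proof (rule LIMSEQ_le_const2[OF sub])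
    have "f (x (s n)) \<le> f (x k)" if "n \<ge> k" for n
      using decseqD[OF decseq_f, of k "s n"] seq_suble[OF s(1), of n] that by simp
    then show "\<exists>N. \<forall>n\<ge>N. f (x (s n)) \<le> f (x k)" by blast
  qed
  obtain L where L: "(\<lambda>k. f (x k)) \<longlonglongrightarrow> L"
    using decseq_convergent[OF decseq_f, of "f q"] le by blast
  then have "(\<lambda>n. f (x (s n))) \<longlonglongrightarrow> L"
    using LIMSEQ_subseq_LIMSEQ[OF L s(1)] by (simp add: o_def)
  then show lim: "(\<lambda>k. f (x k)) \<longlonglongrightarrow> f q" using L sub LIMSEQ_unique by blast
  have "(\<lambda>k. f (x k) - f (x (Suc k))) \<longlonglongrightarrow> f q - f q"
    using lim LIMSEQ_Suc[OF lim] by (intro tendsto_diff)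
  from LIMSEQ_subseq_LIMSEQ[OF this s(1)]
  have "(\<lambda>n. f ((x \<circ> s) n) - f (T ((x \<circ> s) n))) \<longlonglongrightarrow> 0" by (simp add: o_def seq)
  then show "grad f q = 0" using descent_not_null_at_noncritical[OF s(2)] by blast
qed

lemma converges_if_countably_many_critical:
  assumes "countable {p. grad f p = 0}" "grad_loj f"
    and s: "strict_mono s" "(x \<circ> s) \<longlonglongrightarrow> p"
  shows "x \<longlonglongrightarrow> p"
proof (rule converges_if_countably_many_cluster_points[OF assms(1) _ _ s])
  fix r q assume r: "strict_mono r" "(x \<circ> r) \<longlonglongrightarrow> q"
  then have q: "grad f q = 0" by (rule cluster_critical)
  then show "q \<in> {p. grad f p = 0}" by simp
  have "(\<lambda>n. T ((x \<circ> r) n)) \<longlonglongrightarrow> q"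
    using step_continuous_at_critical_lt_1[OF _ r(2) q]
      step_continuous_at_critical_eq_1[OF _ assms(2) r(2) q] tau_le_1 by fastforce
  then show "(\<lambda>n. x (Suc (r n))) \<longlonglongrightarrow> q" by (simp add: seq)
qed

text \<open>The Lojasiewicz inequality raised to the power \<open>1 + \<tau>\<close> matches the
  factor \<open>norm (grad f x) powr (1 + \<tau>)\<close> in the decrease, which gives a descent
  inequality with exponent \<open>\<theta> = \<mu> * (1 + \<tau>) < 1\<close>.\<close>

lemma converges_if_small_lojasiewicz_exponent:
  assumes loj: "loj_at f p" and exp: "loj_exp f p * (1 + \<tau>) < 1"
    and s: "strict_mono s" "(x \<circ> s) \<longlonglongrightarrow> p"
  shows "x \<longlonglongrightarrow> p"
proof -
  let ?E = "{\<mu>. 0 < \<mu> \<and> (\<exists>U C. open U \<and> p \<in> U \<and> C > 0 \<and>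
      (\<forall>x\<in>U. \<bar>f x - f p\<bar> powr \<mu> \<le> C * norm (grad f x)))}"
  \<comment> \<open>With a nonempty set, the strict bound on the infimum yields an actual exponent
    below \<open>1 / (1 + \<tau>)\<close>.\<close>
  have ne: "?E \<noteq> {}" using loj unfolding loj_at_def by blast
  have "Inf ?E < 1 / (1 + \<tau>)"
    using exp tau_pos by (simp add: loj_exp_def field_simps)
  from cInf_lessD[OF ne this] obtain \<mu> where "\<mu> \<in> ?E" and \<mu>1: "\<mu> < 1 / (1 + \<tau>)"
    by blast
  then obtain U C where \<mu>: "0 < \<mu>" and U: "open U" "p \<in> U" and C: "C > 0"
    and ineq: "\<And>x. x \<in> U \<Longrightarrow> \<bar>f x - f p\<bar> powr \<mu> \<le> C * norm (grad f x)" by blast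
  obtain r where r: "r > 0" "ball p r \<subseteq> U" using U openE by blast
  obtain c where c: "c > 0" and len: "\<And>x. x \<in> cball 0 (norm p + r) \<Longrightarrow>
      c * norm (grad f x) powr (1 + \<tau>) * norm (T x - x) \<le> f x - f (T x)"
    using descent_dominates_length by blast
  define \<theta> where "\<theta> = \<mu> * (1 + \<tau>)"
  define e where "e k = f (x k) - f p" for k
  have e0: "0 \<le> e k" for k using cluster_value_le[OF s] by (simp add: e_def)
  show ?thesis
  proof (rule converges_if_lojasiewicz_descent[where e=e and \<theta>=\<theta>, OF r(1) _ _ _ e0 _ _ _ _ s])
    show "0 < C powr (1 + \<tau>) / c" using C c by simp
    show "0 < \<theta>" using \<mu> tau_pos by (simp add: \<theta>_def)
    show "\<theta> < 1" using \<mu>1 tau_pos by (simp add: \<theta>_def field_simps)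
    show "e \<longlonglongrightarrow> 0" unfolding e_def using cluster_value[OF s] by (simp add: LIM_zero)
    show "e (Suc k) \<le> e k" for k by (simp add: e_def seq step_descent)
    show "x (Suc k) = x k" if "e (Suc k) = e k" for k
      using that step_stationary by (simp add: e_def seq)
    fix k assume k: "dist (x k) p < r"
    have "x k \<in> cball 0 (norm p + r)"
      using k norm_triangle_ineq[of p "x k - p"] by (simp add: dist_norm)
    from len[OF this] have dec: "norm (grad f (x k)) powr (1 + \<tau>) * norm (T (x k) - x k) \<le> (e k - e (Suc k)) / c"
      using c by (simp add: e_def seq field_simps)
    have "e k powr \<mu> \<le> C * norm (grad f (x k))"
      using ineq[of "x k"] r k e0[of k] by (auto simp: e_def dist_commute)
    then have "(e k powr \<mu>) powr (1 + \<tau>) \<le> (C * norm (grad f (x k))) powr (1 + \<tau>)"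
      using tau_pos by (intro powr_mono2) auto
    then have "e k powr \<theta> \<le> C powr (1 + \<tau>) * norm (grad f (x k)) powr (1 + \<tau>)"
      using C by (simp add: \<theta>_def powr_powr powr_mult)
    then have "e k powr \<theta> * norm (T (x k) - x k)
        \<le> (C powr (1 + \<tau>) * norm (grad f (x k)) powr (1 + \<tau>)) * norm (T (x k) - x k)"
      by (intro mult_right_mono) auto
    also have "\<dots> \<le> C powr (1 + \<tau>) * ((e k - e (Suc k)) / c)"
      unfolding mult.assoc using dec by (intro mult_left_mono) auto
    finally show "e k powr \<theta> * dist (x k) (x (Suc k)) \<le> C powr (1 + \<tau>) / c * (e k - e (Suc k))"
      by (simp add: dist_norm seq norm_minus_commute)
  qed
qed

end

theorem theorem2:
  fixes f :: "real^'n \<Rightarrow> real" and x :: "nat \<Rightarrow> real^'n"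
    and \<delta> :: "nat \<Rightarrow> real" and \<tau> \<gamma>0 :: real
  assumes "C3 f"
    and "bnqn_params \<delta> \<tau> \<gamma>0 CARD('n)"
    and "\<tau> \<le> 1"
    and "\<And>k. x (Suc k) = bnqn_step \<delta> \<tau> \<gamma>0 f (x k)"
  shows "((\<forall>p. grad f p = 0 \<longrightarrow> loj_at f p) \<and> countable {p. grad f p = 0} \<and> grad_loj f
           \<longrightarrow> filterlim (\<lambda>k. norm (x k)) at_top sequentially \<or>
               (\<exists>p. grad f p = 0 \<and> x \<longlonglongrightarrow> p))
       \<and> ((\<forall>p. grad f p = 0 \<longrightarrow> loj_at f p) \<and>
          (\<forall>p. grad f p = 0 \<longrightarrow> loj_exp f p * (1 + \<tau>) < 1) \<and>
          (\<tau> = 1 \<longrightarrow> grad_loj f)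
           \<longrightarrow> filterlim (\<lambda>k. norm (x k)) at_top sequentially \<or>
               (\<exists>p. grad f p = 0 \<and> x \<longlonglongrightarrow> p))"
proof -
  interpret bnqn_sequence \<delta> \<tau> \<gamma>0 "bnqn_kappa \<delta> CARD('n)" f x
    using assms by unfold_locales auto
  show ?thesis
  proof (cases "filterlim (\<lambda>k. norm (x k)) at_top sequentially")
    \<comment> \<open>Some cluster point exists and is critical; under either set of hypotheses the
      whole sequence converges to it.\<close>
    case False
    then obtain s p where s: "strict_mono s" "(x \<circ> s) \<longlonglongrightarrow> p"
      by (rule cluster_point_if_norm_not_at_top)
    have p: "grad f p = 0" by (rule cluster_critical[OF s])
    show ?thesis
      by (intro conjI impI disjI2 exI[of _ p] p; elim conjE)
        (auto intro: converges_if_countably_many_critical[OF _ _ s]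
          converges_if_small_lojasiewicz_exponent[OF _ _ s] simp: p)
  qed simp
qed

end
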